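(* Let $k$ be a field and $A=k[[t^5,t^{11}]] \subseteq V=k[[t]]$. Let $\mathcal{Y}_A$ denote the set of Ulrich ideals of $A$ which possess the data $(a,b) = (20, 26)$. Then $$\mathcal{Y}_A=\left\{(t^{20} + 3\varepsilon t^{21} + \varepsilon^2 t^{22} + (2\tau - 55 \varepsilon^7)t^{27} + \delta t^{33},\ t^{26} + 2\varepsilon t^{27} + \tau t^{33}) \ \middle|\ \delta, \varepsilon, \tau \in k,\ \varepsilon \ne 0 \right\}.$$ Moreover, the elements $\delta, \varepsilon, \tau \in k$ in this expression of $I \in \mathcal{Y}_A$ are uniquely determined for each $I$.
   Context: $A$ is the semigroup ring of the numerical semigroup $H=\langle 5,11\rangle$, i.e. the subring of $V=k[[t]]$ of power series whose exponents lie in $H$; $\mathrm{o}(\cdot)$ denotes the order (the $t$-adic valuation) on $V$. The field $k$ has arbitrary characteristic. Ulrich ideal: let $(A,\mathfrak m)$ be a Cohen-Macaulay local ring of dimension one and $I$ an $\mathfrak m$-primary ideal containing a parameter ideal $Q=(x)$ as a reduction. $I$ is an Ulrich ideal of $A$ if (1) $I \neq Q$ and $I^2=QI$, and (2) $I/I^2$ is a free $A/I$-module. Let $c=40$ be the conductor of $H$ and $\mathfrak c = A:V = t^{40}V$. An Ulrich ideal $I$ of $A$ possesses the data $(a,b)$ if there are $f,g\in I$ with $a=\mathrm{o}(f)$, $b=\mathrm{o}(g)$ such that: (i) $I=(f,g)$ and $I^2=fI$; (ii) $a,b\in H$ and $0<a<b<a+c$; (iii) $b-a\notin H$, $2b-a\in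 H$, and $a=2\,\ell_A(A/I)$, where $\ell_A$ denotes length; (iv) $t^{c-(b-a)}V\cap A\subseteq I$ and $\mathfrak c\subseteq I$; (v) if $a\ge c$, then the multiplicity of $A$ is $2$ and $I=\mathfrak c$. *)

theory Defs
  imports
    "HOL-Algebra.Ideal_Product"
    "HOL-Algebra.QuotRing"
    "HOL-Algebra.Module"
    "HOL-Computational_Algebra.Formal_Power_Series"
    "HOL-Library.Extended_Nat"
    "HOL-Library.Extended_Real"
begin

section \<open>Modules: freeness and length\<close>

definition free_module :: "('a, 'm) ring_scheme \<Rightarrow> ('a, 'b, 'n) module_scheme \<Rightarrow> bool" where
  "free_module R M \<longleftrightarrow> Module.module R M \<and>
     (\<exists>B \<subseteq> carrier M. \<forall>v \<in> carrier M.
        \<exists>!c. (\<forall>b. c b \<in> carrier R) \<and>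
             finite {b. c b \<noteq> \<zero>\<^bsub>R\<^esub>} \<and> {b. c b \<noteq> \<zero>\<^bsub>R\<^esub>} \<subseteq> B \<and>
             v = finsum M (\<lambda>b. c b \<odot>\<^bsub>M\<^esub> b) {b. c b \<noteq> \<zero>\<^bsub>R\<^esub>})"

definition module_length :: "('a, 'm) ring_scheme \<Rightarrow> ('a, 'b, 'n) module_scheme \<Rightarrow> enat" where
  "module_length R M =
     Sup {enat n | n. \<exists>N. (\<forall>i\<le>n. submodule (N i) R M) \<and> (\<forall>i<n. N i \<subset> N (Suc i))}"

text \<open>The cyclic module \<open>R/I\<close> over \<open>R\<close> (scalars act through \<open>R \<rightarrow> R/I\<close>).\<close>

definition cyclic_module :: "('a, 'm) ring_scheme \<Rightarrow> 'a set \<Rightarrow> ('a, 'a set) module" where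
  "cyclic_module R I =
     \<lparr>carrier = carrier (R Quot I), monoid.mult = monoid.mult (R Quot I), one = one (R Quot I),
      zero = zero (R Quot I), add = add (R Quot I),
      smult = (\<lambda>a X. (I +>\<^bsub>R\<^esub> a) \<otimes>\<^bsub>R Quot I\<^esub> X)\<rparr>"

text \<open>
  The module \<open>I/I\<^sup>2\<close> over \<open>R/I\<close>. A coset of \<open>I\<close> times a coset of \<open>I\<^sup>2\<close> contained in \<open>I\<close>
  is, elementwise, a single coset of \<open>I\<^sup>2\<close>, so \<^const>\<open>rcoset_mult\<close> modulo \<open>I\<^sup>2\<close> is the scalar action.
  The fields \<^const>\<open>monoid.mult\<close> and \<^const>\<open>one\<close> play no role in a module record.
\<close>

definition conormal_module :: "('a, 'm) ring_scheme \<Rightarrow> 'a set \<Rightarrow> ('a set, 'a set) module" where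
  "conormal_module R I =
     (let I2 = ideal_prod R I I in
     \<lparr>carrier = (\<lambda>x. I2 +>\<^bsub>R\<^esub> x) ` I, monoid.mult = rcoset_mult R I2, one = I2,
      zero = I2, add = set_add R, smult = rcoset_mult R I2\<rparr>)"


section \<open>Ulrich ideals\<close>

definition local_ring :: "('a, 'm) ring_scheme \<Rightarrow> bool" where
  "local_ring R \<longleftrightarrow> cring R \<and> (\<exists>!M. maximalideal M R)"

definition max_ideal :: "('a, 'm) ring_scheme \<Rightarrow> 'a set" where
  "max_ideal R = (THE M. maximalideal M R)"

definition radical_of :: "('a, 'm) ring_scheme \<Rightarrow> 'a set \<Rightarrow> 'a set" where
  "radical_of R I = {a \<in> carrier R. \<exists>n::nat. a [^]\<^bsub>R\<^esub> n \<in> I}"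

definition primary_ideal :: "('a, 'm) ring_scheme \<Rightarrow> 'a set \<Rightarrow> bool" where
  "primary_ideal R I \<longleftrightarrow> ideal I R \<and> I \<noteq> carrier R \<and>
     (\<forall>a \<in> carrier R. \<forall>b \<in> carrier R. a \<otimes>\<^bsub>R\<^esub> b \<in> I \<longrightarrow> a \<in> I \<or> b \<in> radical_of R I)"

definition primary_to :: "('a, 'm) ring_scheme \<Rightarrow> 'a set \<Rightarrow> 'a set \<Rightarrow> bool" where
  "primary_to R P I \<longleftrightarrow> primary_ideal R I \<and> radical_of R I = P"

definition reduction_of :: "('a, 'm) ring_scheme \<Rightarrow> 'a set \<Rightarrow> 'a set \<Rightarrow> bool" where
  "reduction_of R Q I \<longleftrightarrow> Q \<subseteq> I \<and>
     (\<exists>n::nat. I [^]\<^bsub>ideals_set R\<^esub> Suc n = ideal_prod R Q (I [^]\<^bsub>ideals_set R\<^esub> n))"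

text \<open>
  For a Cohen--Macaulay local ring \<open>R\<close> of dimension one; there \<open>(x)\<close> is a parameter ideal iff it is
  primary to the maximal ideal. Being Cohen--Macaulay of dimension one is a standing assumption
  on \<open>R\<close>, satisfied by the one-dimensional Noetherian local domains \<open>k[[H]]\<close> below.
\<close>

definition Ulrich_ideal :: "('a, 'm) ring_scheme \<Rightarrow> 'a set \<Rightarrow> bool" where
  "Ulrich_ideal R I \<longleftrightarrow> local_ring R \<and> primary_to R (max_ideal R) I \<and>
     (\<exists>x \<in> carrier R. let Q = genideal R {x} in
        primary_to R (max_ideal R) Q \<and> reduction_of R Q I \<and>
        I \<noteq> Q \<and> ideal_prod R I I = ideal_prod R Q I \<and>
        free_module (R Quot I) (conormal_module R I))"

text \<open>Hilbert--Samuel multiplicity of a local ring of dimension one.\<close>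

definition multiplicity1 :: "('a, 'm) ring_scheme \<Rightarrow> ereal" where
  "multiplicity1 R =
     lim (\<lambda>n. ereal_of_enat
                (module_length R (cyclic_module R (max_ideal R [^]\<^bsub>ideals_set R\<^esub> Suc n)))
              / ereal (real (Suc n)))"


section \<open>Numerical semigroup rings\<close>

definition semigroup_5_11 :: "nat set" where
  "semigroup_5_11 = {5 * i + 11 * j | i j. True}"

definition semigroup_ring :: "nat set \<Rightarrow> 'k::field fps ring" where
  "semigroup_ring H =
     \<lparr>carrier = {f. \<forall>n. fps_nth f n \<noteq> 0 \<longrightarrow> n \<in> H}, monoid.mult = (*), one = 1, zero = 0, add = (+)\<rparr>"

definition conductor :: "nat set \<Rightarrow> nat" where
  "conductor H = (LEAST c. \<forall>n\<ge>c. n \<in> H)"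

text \<open>The colon \<open>A : V\<close>; it lies in \<open>A\<close> because \<open>1 \<in> V\<close>.\<close>

definition conductor_ideal :: "nat set \<Rightarrow> 'k::field fps set" where
  "conductor_ideal H = {f. \<forall>v. f * v \<in> carrier (semigroup_ring H)}"

text \<open>
  For \<open>f \<noteq> 0\<close> the order \<open>o(f)\<close> is \<^const>\<open>subdegree\<close>; the library sets \<open>subdegree 0 = 0\<close>, whence the
  explicit nonvanishing. All subtractions on \<open>nat\<close> below are exact since \<open>a < b < a + c\<close>.
\<close>

definition possesses_data :: "nat set \<Rightarrow> 'k::field fps set \<Rightarrow> nat \<Rightarrow> nat \<Rightarrow> bool" where
  "possesses_data H I a b \<longleftrightarrow>
     (let A = semigroup_ring H; c = conductor H in
      \<exists>f \<in> I. \<exists>g \<in> I. f \<noteq> 0 \<and> g \<noteq> 0 \<and> a = subdegree f \<and> b = subdegree g \<and>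
        I = genideal A {f, g} \<and> ideal_prod A I I = (\<lambda>h. f * h) ` I \<and>
        a \<in> H \<and> b \<in> H \<and> 0 < a \<and> a < b \<and> b < a + c \<and>
        b - a \<notin> H \<and> 2 * b - a \<in> H \<and> enat a = 2 * module_length A (cyclic_module A I) \<and>
        range (\<lambda>v. fps_X ^ (c - (b - a)) * v) \<inter> carrier A \<subseteq> I \<and> conductor_ideal H \<subseteq> I \<and>
        (a \<ge> c \<longrightarrow> multiplicity1 A = 2 \<and> I = conductor_ideal H))"

definition Ulrich_ideals_with_data :: "nat set \<Rightarrow> nat \<Rightarrow> nat \<Rightarrow> 'k::field fps set set" where
  "Ulrich_ideals_with_data H a b = {I. Ulrich_ideal (semigroup_ring H) I \<and> possesses_data H I a b}"

definition param_ideal :: "'k::field \<Rightarrow> 'k \<Rightarrow> 'k \<Rightarrow> 'k fps set" where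
  "param_ideal \<delta> \<epsilon> \<tau> =
     genideal (semigroup_ring semigroup_5_11)
       {fps_X ^ 20 + fps_const (3 * \<epsilon>) * fps_X ^ 21 + fps_const (\<epsilon> ^ 2) * fps_X ^ 22
          + fps_const (2 * \<tau> - 55 * \<epsilon> ^ 7) * fps_X ^ 27 + fps_const \<delta> * fps_X ^ 33,
        fps_X ^ 26 + fps_const (2 * \<epsilon>) * fps_X ^ 27 + fps_const \<tau> * fps_X ^ 33}"


unbundle fps_syntax

section \<open>Sanity checks: the ring is local, and the conductor is as expected\<close>

lemma semigroup_ring_simps [simp]:
  "carrier (semigroup_ring H) = {f. \<forall>n. fps_nth f n \<noteq> 0 \<longrightarrow> n \<in> H}"
  "monoid.mult (semigroup_ring H) = (*)" "one (semigroup_ring H) = 1"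
  "zero (semigroup_ring H) = 0" "add (semigroup_ring H) = (+)"
  by (simp_all add: semigroup_ring_def)

lemma cring_semigroup_ring:
  assumes "0 \<in> H" and add: "\<And>m n. m \<in> H \<Longrightarrow> n \<in> H \<Longrightarrow> m + n \<in> H"
  shows "cring (semigroup_ring H :: 'k::field fps ring)"
proof (rule cringI)
  show "abelian_group (semigroup_ring H :: 'k fps ring)"
  proof (rule abelian_groupI)
    fix x y :: "'k fps"
    assume "x \<in> carrier (semigroup_ring H)" "y \<in> carrier (semigroup_ring H)"
    thus "x \<oplus>\<^bsub>semigroup_ring H\<^esub> y \<in> carrier (semigroup_ring H)"
      by simp (metis add.right_neutral)
  next
    fix x :: "'k fps" assume "x \<in> carrier (semigroup_ring H)"
    thus "\<exists>y \<in> carrier (semigroup_ring H). y \<oplus>\<^bsub>semigroup_ring H\<^esub> x = \<zero>\<^bsub>semigroup_ring H\<^esub>"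
      by (intro bexI[of _ "- x"]) simp_all
  qed (simp_all add: algebra_simps)
  have mult: "n \<in> H" if "\<forall>n. x $ n \<noteq> 0 \<longrightarrow> n \<in> H" "\<forall>n. y $ n \<noteq> 0 \<longrightarrow> n \<in> H" "(x * y) $ n \<noteq> 0"
    for x y :: "'k fps" and n
  proof -
    from that(3) obtain i where "i \<in> {0..n}" "x $ i * y $ (n - i) \<noteq> 0"
      unfolding fps_mult_nth by (meson sum.neutral)
    thus ?thesis using that(1,2) add[of i "n - i"] by auto
  qed
  show "Group.comm_monoid (semigroup_ring H :: 'k fps ring)"
  proof (rule comm_monoidI)
    fix x y :: "'k fps"
    assume "x \<in> carrier (semigroup_ring H)" "y \<in> carrier (semigroup_ring H)"
    thus "x \<otimes>\<^bsub>semigroup_ring H\<^esub> y \<in> carrier (semigroup_ring H)"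
      using mult[of x y] by simp
  qed (use \<open>0 \<in> H\<close> in \<open>simp_all add: mult.assoc mult.commute\<close>)
qed (simp add: algebra_simps)

lemma semigroup_ring_inverse:
  fixes f :: "'k::field fps"
  assumes add: "\<And>m n. m \<in> H \<Longrightarrow> n \<in> H \<Longrightarrow> m + n \<in> H" and "0 \<in> H"
    and f: "f \<in> carrier (semigroup_ring H)" "f $ 0 \<noteq> 0"
  shows "inverse f \<in> carrier (semigroup_ring H)"
proof -
  have "n \<in> H \<or> inverse f $ n = 0" for n
  proof (induction n rule: less_induct)
    case (less n)
    show ?case
    proof (cases "n \<in> H")
      case False
      with \<open>0 \<in> H\<close> have "n > 0" by (metis gr0I)
      have "f $ i * inverse f $ (n - i) = 0" if "i \<in> {1..n}" for i
      proof (rule ccontr)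
        assume "f $ i * inverse f $ (n - i) \<noteq> 0"
        hence "i \<in> H" "n - i \<in> H" using f(1) less.IH[of "n - i"] that by auto
        with add[of i "n - i"] that False show False by simp
      qed
      hence "(\<Sum>i = 1..n. f $ i * inverse f $ (n - i)) = 0" by (intro sum.neutral) blast
      moreover have "(\<Sum>i = 0..n. f $ i * inverse f $ (n - i)) = 0"
        using inverse_mult_eq_1'[OF f(2)] \<open>n > 0\<close> by (metis fps_mult_nth fps_one_nth less_irrefl)
      ultimately show ?thesis using f(2) by (simp add: sum.atLeast_Suc_atMost)
    qed simp
  qed
  thus ?thesis by auto
qed

lemma maximalideal_semigroup_ring:
  assumes "0 \<in> H" and add: "\<And>m n. m \<in> H \<Longrightarrow> n \<in> H \<Longrightarrow> m + n \<in> H"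
  shows "maximalideal M (semigroup_ring H :: 'k::field fps ring) \<longleftrightarrow>
         M = {f \<in> carrier (semigroup_ring H). f $ 0 = 0}"
proof -
  define A where "A = (semigroup_ring H :: 'k fps ring)"
  define P where "P = {f \<in> carrier A. f $ 0 = 0}"
  interpret cring A unfolding A_def by (rule cring_semigroup_ring[OF assms])
  have A: "add A = (+)" "monoid.mult A = (*)" "zero A = 0" "one A = 1" by (simp_all add: A_def)
  have P: "ideal P A"
  proof (rule idealI)
    show "subgroup P (add_monoid A)"
    proof (rule add.subgroupI)
      show "P \<subseteq> carrier A" by (auto simp: P_def)
      show "P \<noteq> {}" using zero_closed by (auto simp: P_def A)
    next
      fix a b assume a: "a \<in> P" and b: "b \<in> P"
      show "a \<oplus>\<^bsub>A\<^esub> b \<in> P"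
        using a b add.m_closed[of a b] by (auto simp: P_def A)
    next
      fix a assume a: "a \<in> P"
      have "\<ominus>\<^bsub>A\<^esub> a \<oplus>\<^bsub>A\<^esub> a = \<zero>\<^bsub>A\<^esub>" using a by (auto simp: P_def l_neg)
      hence "\<ominus>\<^bsub>A\<^esub> a = - a" by (simp add: A eq_neg_iff_add_eq_0)
      thus "\<ominus>\<^bsub>A\<^esub> a \<in> P"
        using a a_inv_closed[of a] by (auto simp: P_def)
    qed
  qed (use m_closed in \<open>auto simp: P_def A ring_axioms\<close>)
  have full: "J = carrier A" if J: "ideal J A" "\<not> J \<subseteq> P" for J
  proof -
    interpret J: ideal J A by fact
    from J(2) obtain f where f: "f \<in> J" "f \<notin> P" by blast
    hence "f \<in> carrier A" "f $ 0 \<noteq> 0" using J.Icarr by (auto simp: P_def)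
    moreover from this have "inverse f \<in> carrier A"
      using semigroup_ring_inverse[OF add] assms(1) unfolding A_def by blast
    ultimately have "\<one>\<^bsub>A\<^esub> \<in> J" using J.I_l_closed[OF f(1), of "inverse f"]
      by (simp add: A inverse_mult_eq_1)
    thus ?thesis by (rule J.one_imp_carrier)
  qed
  have "(1 :: 'k fps) \<notin> P" by (simp add: P_def)
  hence ne: "P \<noteq> carrier A" using one_closed by (auto simp: A)
  have "maximalideal P A" using P ne full by (intro maximalidealI) blast+
  moreover have "M = P" if "maximalideal M A"
  proof -
    interpret M: maximalideal M A by fact
    have "M \<subseteq> P" using full M.is_ideal M.I_notcarr by metis
    thus ?thesis using M.I_maximal[OF P] ne by (auto simp: P_def)
  qed
  ultimately show ?thesis unfolding P_def A_def by blast
qed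

corollary local_ring_semigroup_ring:
  assumes "0 \<in> H" "\<And>m n. m \<in> H \<Longrightarrow> n \<in> H \<Longrightarrow> m + n \<in> H"
  shows "local_ring (semigroup_ring H :: 'k::field fps ring)"
    and "max_ideal (semigroup_ring H :: 'k fps ring) = {f \<in> carrier (semigroup_ring H). f $ 0 = 0}"
proof -
  have M: "maximalideal M (semigroup_ring H :: 'k fps ring) \<longleftrightarrow>
           M = {f \<in> carrier (semigroup_ring H). f $ 0 = 0}" for M
    by (rule maximalideal_semigroup_ring) (fact assms)+
  have "cring (semigroup_ring H :: 'k fps ring)"
    by (rule cring_semigroup_ring) (fact assms)+
  thus "local_ring (semigroup_ring H :: 'k fps ring)" unfolding local_ring_def M by blast
  show "max_ideal (semigroup_ring H :: 'k fps ring) = {f \<in> carrier (semigroup_ring H). f $ 0 = 0}"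
    unfolding max_ideal_def M by (rule the_eq_trivial)
qed

lemma semigroup_5_11_closed:
  "0 \<in> semigroup_5_11" "m \<in> semigroup_5_11 \<Longrightarrow> n \<in> semigroup_5_11 \<Longrightarrow> m + n \<in> semigroup_5_11"
proof -
  show "0 \<in> semigroup_5_11" by (simp add: semigroup_5_11_def)
  assume "m \<in> semigroup_5_11" "n \<in> semigroup_5_11"
  then obtain i j i' j' where "m = 5 * i + 11 * j" "n = 5 * i' + 11 * j'"
    by (auto simp: semigroup_5_11_def)
  hence "m + n = 5 * (i + i') + 11 * (j + j')" by simp
  thus "m + n \<in> semigroup_5_11" unfolding semigroup_5_11_def by blast
qed

lemma conductor_5_11: "conductor semigroup_5_11 = 40"
proof -
  have in_H: "n \<in> semigroup_5_11" if "n \<ge> 40" for n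
  proof -
    have "\<exists>i j. n = 5 * i + 11 * j" using that by presburger
    thus ?thesis by (simp add: semigroup_5_11_def)
  qed
  have "39 \<noteq> 5 * i + 11 * j" for i j :: nat by presburger
  hence "39 \<notin> semigroup_5_11" by (simp add: semigroup_5_11_def)
  thus ?thesis unfolding conductor_def
  proof (intro Least_equality allI impI in_H)
    fix c :: nat assume c: "\<forall>n\<ge>c. n \<in> semigroup_5_11"
    show "40 \<le> c"
    proof (rule ccontr)
      assume "\<not> 40 \<le> c"
      hence "c \<le> 39" by simp
      with c \<open>39 \<notin> semigroup_5_11\<close> show False by blast
    qed
  qed
qed

lemma conductor_ideal_5_11:
  "(conductor_ideal semigroup_5_11 :: 'k::field fps set) = range (\<lambda>v. fps_X ^ 40 * v)"
proof (intro equalityI subsetI)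
  fix f :: "'k fps" assume f: "f \<in> conductor_ideal semigroup_5_11"
  have "39 \<noteq> 5 * i + 11 * j" for i j :: nat by presburger
  hence n39: "39 \<notin> semigroup_5_11" by (simp add: semigroup_5_11_def)
  have "f $ n = 0" if "n < 40" for n
  proof -
    have "(f * fps_X ^ (39 - n)) $ 39 = 0" using f n39 by (auto simp: conductor_ideal_def)
    moreover have "39 - (39 - n) = n" "\<not> 39 < 39 - n" using that by simp_all
    ultimately show ?thesis by (simp add: fps_X_power_mult_right_nth)
  qed
  hence "f = fps_X ^ 40 * fps_shift 40 f"
    by (intro fps_ext) (simp add: fps_X_power_mult_nth)
  thus "f \<in> range (\<lambda>v. fps_X ^ 40 * v)" by blast
next
  fix f :: "'k fps" assume "f \<in> range (\<lambda>v. fps_X ^ 40 * v)"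
  then obtain v where v: "f = fps_X ^ 40 * v" by blast
  have "n \<in> semigroup_5_11" if "n \<ge> 40" for n
  proof -
    have "\<exists>i j. n = 5 * i + 11 * j" using that by presburger
    thus ?thesis by (simp add: semigroup_5_11_def)
  qed
  thus "f \<in> conductor_ideal semigroup_5_11"
    by (auto simp: conductor_ideal_def v mult.assoc fps_X_power_mult_nth not_less[symmetric])
qed

end

theory Submission
  imports Defs
begin

text \<open>
  Let \<open>H = \<langle>5,11\<rangle>\<close>, and let \<open>f\<close>, \<open>g\<close> have orders 20 and 26. The equality \<open>I\<^sup>2 = f I\<close> for \<open>I = (f,g)\<close>
  says that \<open>B = A + A (g/f)\<close> is a ring, and \<open>I = f B\<close>. As \<open>g/f\<close> has order 6, the ring \<open>B\<close> has
  elements of all orders in \<open>\<langle>5,6\<rangle>\<close>, so \<open>I\<close> has elements of all orders in \<open>20 + \<langle>5,6\<rangle>\<close>; five of them,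
  one for each residue class modulo 5, yield all others through multiplication by powers of \<open>t\<^sup>5\<close>
  (\<open>ex_five_orders\<close>, \<open>ex_prescribed\<close>).

  No further orders occur, by a duality that comes from the symmetry of \<open>\<langle>5,6\<rangle>\<close> (\<open>multiplier_order\<close>):
  if \<open>n \<in> H\<close> is not in \<open>20 + \<langle>5,6\<rangle>\<close> then \<open>59 - n\<close> is, so an element \<open>q\<close> of order \<open>n\<close> with \<open>q I \<subseteq> f A\<close>
  would lead to an element of order 59 in \<open>f A\<close>, although \<open>59 - 20 = 39\<close> is a gap of \<open>H\<close>. Applied to
  \<open>q \<in> I\<close>, this determines the orders in \<open>I\<close>, and \<open>A/I\<close> has length 10, the number of elements of \<open>H\<close>
  outside \<open>20 + \<langle>5,6\<rangle>\<close>. Applied to arbitrary \<open>q\<close>, it gives \<open>fA : g = I\<close>, which is the freeness of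
  \<open>I/I\<^sup>2\<close>. Hence every such pair generates an Ulrich ideal with data \<open>(20,26)\<close>.

  For the classification, the elements of \<open>H\<close> above 20 that are not orders in \<open>I\<close> are 21, 22, 27
  and 33. So \<open>I\<close> has unique generators \<open>f = t\<^sup>2\<^sup>0 + a\<^sub>1 t\<^sup>2\<^sup>1 + a\<^sub>2 t\<^sup>2\<^sup>2 + a\<^sub>3 t\<^sup>2\<^sup>7 + a\<^sub>4 t\<^sup>3\<^sup>3\<close> and
  \<open>g = t\<^sup>2\<^sup>6 + b\<^sub>1 t\<^sup>2\<^sup>7 + b\<^sub>2 t\<^sup>3\<^sup>3\<close>, and only \<open>g\<^sup>2 \<in> f I\<close> restricts their coefficients. As \<open>f I\<close> contains
  \<open>t\<^sup>6\<^sup>0 V\<close> and has the orders \<open>40 + \<langle>5,6\<rangle>\<close>, the condition consists of one equation at each of the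
  exponents 53, 54 and 59. They leave three of the six coefficients free: with \<open>\<epsilon> = a\<^sub>1 - b\<^sub>1\<close>,
  nonzero because 32 is an order, one finds \<open>b\<^sub>1 = 2 \<epsilon>\<close>, \<open>a\<^sub>2 = \<epsilon>\<^sup>2\<close> and \<open>a\<^sub>3 = 2 b\<^sub>2 - 55 \<epsilon>\<^sup>7\<close>
  (\<open>defect_special\<close>, \<open>ex_param\<close>).
\<close>

section \<open>Two-generated ideals, conormal modules and cyclic modules\<close>

lemma (in cring) genideal_pair:
  assumes f: "f \<in> carrier R" and g: "g \<in> carrier R"
  shows "Idl {f, g} = {p \<otimes> f \<oplus> q \<otimes> g | p q. p \<in> carrier R \<and> q \<in> carrier R}" (is "_ = ?J")
proof
  have "ideal ?J R"
  proof (rule idealI[OF ring_axioms])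
    show "subgroup ?J (add_monoid R)"
    proof (rule add.subgroupI)
      show "?J \<subseteq> carrier R" using f g by auto
      show "?J \<noteq> {}" using zero_closed by blast
    next
      fix a assume "a \<in> ?J"
      then obtain p q where pq: "p \<in> carrier R" "q \<in> carrier R" "a = p \<otimes> f \<oplus> q \<otimes> g" by blast
      hence "\<ominus> a = (\<ominus> p) \<otimes> f \<oplus> (\<ominus> q) \<otimes> g" using f g by algebra
      thus "\<ominus> a \<in> ?J" using pq by blast
    next
      fix a b assume "a \<in> ?J" "b \<in> ?J"
      then obtain p q p' q' where pq: "p \<in> carrier R" "q \<in> carrier R" "a = p \<otimes> f \<oplus> q \<otimes> g"
        "p' \<in> carrier R" "q' \<in> carrier R" "b = p' \<otimes> f \<oplus> q' \<otimes> g" by blast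
      hence "a \<oplus> b = (p \<oplus> p') \<otimes> f \<oplus> (q \<oplus> q') \<otimes> g" using f g by algebra
      thus "a \<oplus> b \<in> ?J" using pq by blast
    qed
  next
    fix a x assume "a \<in> ?J" and x: "x \<in> carrier R"
    then obtain p q where pq: "p \<in> carrier R" "q \<in> carrier R" "a = p \<otimes> f \<oplus> q \<otimes> g" by blast
    hence "x \<otimes> a = (x \<otimes> p) \<otimes> f \<oplus> (x \<otimes> q) \<otimes> g" "a \<otimes> x = (x \<otimes> p) \<otimes> f \<oplus> (x \<otimes> q) \<otimes> g"
      using f g x by algebra+
    thus "x \<otimes> a \<in> ?J" "a \<otimes> x \<in> ?J" using pq x by blast+
  qed
  moreover have "f \<in> ?J" "g \<in> ?J"
  proof -
    have "f = \<one> \<otimes> f \<oplus> \<zero> \<otimes> g" "g = \<zero> \<otimes> f \<oplus> \<one> \<otimes> g" using f g by algebra+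
    thus "f \<in> ?J" "g \<in> ?J" by blast+
  qed
  ultimately show "Idl {f, g} \<subseteq> ?J" by (intro genideal_minimal) auto
next
  interpret I: ideal "Idl {f, g}" R using f g by (intro genideal_ideal) auto
  have "f \<in> Idl {f, g}" "g \<in> Idl {f, g}" using f g genideal_self[of "{f, g}"] by auto
  thus "?J \<subseteq> Idl {f, g}" by (auto intro!: I.a_closed I.I_l_closed)
qed

lemma (in ideal) rcos_eq_iff:
  assumes "x \<in> carrier R" "y \<in> carrier R"
  shows "I +> x = I +> y \<longleftrightarrow> x \<ominus> y \<in> I"
  using quotient_eq_iff_same_a_r_cos[OF is_ideal assms] by simp

text \<open>
  Coset multiplication, taken modulo \<open>I\<^sup>2\<close>, is a well defined action of
  \<open>R/I\<close> on \<open>I/I\<^sup>2\<close> because changing the scalar by \<open>I\<close> changes the product by \<open>I \<cdot> I\<close>.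
\<close>

lemma (in cring) rcoset_mult_conormal:
  assumes I: "ideal I R" and a: "a \<in> carrier R" and x: "x \<in> I"
  shows "rcoset_mult R (I \<cdot> I) (I +> a) ((I \<cdot> I) +> x) = (I \<cdot> I) +> (a \<otimes> x)"
proof -
  interpret I: ideal I R by fact
  interpret I2: ideal "I \<cdot> I" R by (rule ideal_prod_is_ideal[OF I I])
  have sub: "I \<cdot> I \<subseteq> I" using ideal_prod_inter[OF I I] by blast
  have xc: "x \<in> carrier R" using x I.Icarr by blast
  have eq: "(I \<cdot> I) +> (a' \<otimes> x') = (I \<cdot> I) +> (a \<otimes> x)"
    if a': "a' \<in> I +> a" and x': "x' \<in> (I \<cdot> I) +> x" for a' x'
  proof -
    have c: "a' \<in> carrier R" "x' \<in> carrier R"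
      using a' x' a xc I.a_elemrcos_carrier I2.a_elemrcos_carrier by blast+
    have d: "a' \<ominus> a \<in> I" "x' \<ominus> x \<in> I \<cdot> I"
      using a' x' I.a_rcos_module_minus[OF ring_axioms] I2.a_rcos_module_minus[OF ring_axioms] a xc c
      by blast+
    have "a' \<otimes> x' \<ominus> a \<otimes> x = a' \<otimes> (x' \<ominus> x) \<oplus> (a' \<ominus> a) \<otimes> x" using a xc c by algebra
    also have "\<dots> \<in> I \<cdot> I"
      using d c x by (intro I2.a_closed I2.I_l_closed ideal_prod.prod)
    finally show ?thesis using I2.rcos_eq_iff a xc c by simp
  qed
  have "a \<in> I +> a" "x \<in> (I \<cdot> I) +> x" using a xc I.a_rcos_self I2.a_rcos_self by blast+
  thus ?thesis unfolding rcoset_mult_def using eq by blast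
qed

lemma conormal_module_simps:
  "carrier (conormal_module R I) = (\<lambda>x. ideal_prod R I I +>\<^bsub>R\<^esub> x) ` I"
  "add (conormal_module R I) = set_add R"
  "zero (conormal_module R I) = ideal_prod R I I"
  "smult (conormal_module R I) = rcoset_mult R (ideal_prod R I I)"
  by (simp_all add: conormal_module_def Let_def)

lemma FactRing_ops:
  "add (R Quot I) = set_add R" "monoid.mult (R Quot I) = rcoset_mult R I"
  "zero (R Quot I) = I" "one (R Quot I) = I +>\<^bsub>R\<^esub> \<one>\<^bsub>R\<^esub>"
  by (simp_all add: FactRing_def)

lemma (in cring) FactRing_carrier_eq: "carrier (R Quot I) = (\<lambda>a. I +> a) ` carrier R"
  by (auto simp: FactRing_def A_RCOSETS_def' )

lemma (in cring) module_conormal: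
  assumes I: "ideal I R"
  shows "Module.module (R Quot I) (conormal_module R I)"
proof -
  interpret I: ideal I R by fact
  interpret I2: ideal "I \<cdot> I" R by (rule ideal_prod_is_ideal[OF I I])
  note mult = rcoset_mult_conormal[OF I]
  have car: "x \<in> carrier R" if "x \<in> I" for x using that I.Icarr by blast
  have add: "((I \<cdot> I) +> x) <+> ((I \<cdot> I) +> y) = (I \<cdot> I) +> (x \<oplus> y)" if "x \<in> I" "y \<in> I" for x y
    using that car I2.a_rcos_sum by blast
  have zero: "I \<cdot> I = (I \<cdot> I) +> \<zero>" using I2.a_subset by simp
  show ?thesis
  proof (rule Module.moduleI)
    show "cring (R Quot I)" by (rule I.quotient_is_cring[OF is_cring])
    show "abelian_group (conormal_module R I)"
    proof (rule abelian_groupI; (unfold conormal_module_simps)?)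
      fix x assume "x \<in> (\<lambda>x. I \<cdot> I +> x) ` I"
      then obtain u where u: "u \<in> I" "x = I \<cdot> I +> u" by blast
      show "\<exists>y\<in>(\<lambda>x. I \<cdot> I +> x) ` I. y <+> x = I \<cdot> I"
        using u car[OF u(1)] I.a_inv_closed[OF u(1)] zero
        by (intro bexI[of _ "I \<cdot> I +> (\<ominus> u)"]) (simp_all add: add l_neg)
      show "I \<cdot> I <+> x = x" using u car[OF u(1)] add[OF I.zero_closed u(1)] zero by simp
    next
      show "I \<cdot> I \<in> (\<lambda>x. I \<cdot> I +> x) ` I" using zero I.zero_closed by blast
    qed (auto simp: add car a_ac)
  next
    fix a x assume "a \<in> carrier (R Quot I)" "x \<in> carrier (conormal_module R I)"
    then show "a \<odot>\<^bsub>conormal_module R I\<^esub> x \<in> carrier (conormal_module R I)"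
      by (auto simp: conormal_module_simps FactRing_carrier_eq mult I.I_l_closed)
  next
    fix a b x
    assume "a \<in> carrier (R Quot I)" "b \<in> carrier (R Quot I)" "x \<in> carrier (conormal_module R I)"
    then show "(a \<oplus>\<^bsub>R Quot I\<^esub> b) \<odot>\<^bsub>conormal_module R I\<^esub> x =
        (a \<odot>\<^bsub>conormal_module R I\<^esub> x) \<oplus>\<^bsub>conormal_module R I\<^esub> (b \<odot>\<^bsub>conormal_module R I\<^esub> x)"
      by (auto simp: conormal_module_simps FactRing_carrier_eq mult I.I_l_closed add car
          FactRing_ops I.a_rcos_sum l_distr)
  next
    fix a x y
    assume "a \<in> carrier (R Quot I)" "x \<in> carrier (conormal_module R I)"
      "y \<in> carrier (conormal_module R I)"
    then show "a \<odot>\<^bsub>conormal_module R I\<^esub> (x \<oplus>\<^bsub>conormal_module R I\<^esub> y) =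
        (a \<odot>\<^bsub>conormal_module R I\<^esub> x) \<oplus>\<^bsub>conormal_module R I\<^esub> (a \<odot>\<^bsub>conormal_module R I\<^esub> y)"
      by (auto simp: conormal_module_simps FactRing_carrier_eq mult I.I_l_closed add car r_distr)
  next
    fix a b x
    assume "a \<in> carrier (R Quot I)" "b \<in> carrier (R Quot I)" "x \<in> carrier (conormal_module R I)"
    then show "(a \<otimes>\<^bsub>R Quot I\<^esub> b) \<odot>\<^bsub>conormal_module R I\<^esub> x =
        a \<odot>\<^bsub>conormal_module R I\<^esub> (b \<odot>\<^bsub>conormal_module R I\<^esub> x)"
      by (auto simp: conormal_module_simps FactRing_carrier_eq mult I.I_l_closed car
          FactRing_ops I.rcoset_mult_add m_assoc)
  next
    fix x assume "x \<in> carrier (conormal_module R I)"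
    then show "\<one>\<^bsub>R Quot I\<^esub> \<odot>\<^bsub>conormal_module R I\<^esub> x = x"
      by (auto simp: conormal_module_simps FactRing_ops mult car)
  qed
qed

text \<open>
  Generators \<open>f, g\<close> of \<open>I\<close> induce a basis of \<open>I/I\<^sup>2\<close> over \<open>R/I\<close> as soon as a relation
  \<open>p f + q g \<in> I\<^sup>2\<close> forces \<open>p, q \<in> I\<close>. The two classes are distinct, since \<open>1 f - 1 g \<in> I\<^sup>2\<close>
  would put 1 into \<open>I\<close>.
\<close>

lemma (in cring) free_conormal_moduleI:
  assumes I: "ideal I R" and ne: "I \<noteq> carrier R"
    and f: "f \<in> I" and g: "g \<in> I"
    and span: "\<And>x. x \<in> I \<Longrightarrow> \<exists>p\<in>carrier R. \<exists>q\<in>carrier R. x = p \<otimes> f \<oplus> q \<otimes> g"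
    and indep: "\<And>p q. p \<in> carrier R \<Longrightarrow> q \<in> carrier R \<Longrightarrow> p \<otimes> f \<oplus> q \<otimes> g \<in> I \<cdot> I \<Longrightarrow> p \<in> I \<and> q \<in> I"
  shows "free_module (R Quot I) (conormal_module R I)"
proof -
  interpret I: ideal I R by fact
  interpret I2: ideal "I \<cdot> I" R by (rule ideal_prod_is_ideal[OF I I])
  interpret M: Module.module "R Quot I" "conormal_module R I" by (rule module_conormal[OF I])
  note mult = rcoset_mult_conormal[OF I]
  let ?M = "conormal_module R I" and ?Q = "R Quot I"
  have car: "x \<in> carrier R" if "x \<in> I" for x using that I.Icarr by blast
  have fc: "f \<in> carrier R" and gc: "g \<in> carrier R" using f g car by blast+
  define F where "F = I \<cdot> I +> f"
  define G where "G = I \<cdot> I +> g"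
  have FG: "F \<in> carrier ?M" "G \<in> carrier ?M" using f g by (auto simp: conormal_module_simps F_def G_def)
  have FneG: "F \<noteq> G"
  proof
    assume "F = G"
    hence "f \<ominus> g \<in> I \<cdot> I" using I2.rcos_eq_iff[OF fc gc] by (simp add: F_def G_def)
    moreover have "f \<ominus> g = \<one> \<otimes> f \<oplus> (\<ominus> \<one>) \<otimes> g" using fc gc by algebra
    ultimately have "\<one> \<in> I" using indep[of \<one> "\<ominus> \<one>"] by simp
    thus False using ne I.one_imp_carrier by blast
  qed
  have zeroQ: "\<zero>\<^bsub>?Q\<^esub> = I" by (simp add: FactRing_ops)
  have comb: "finsum ?M (\<lambda>b. c b \<odot>\<^bsub>?M\<^esub> b) {b. c b \<noteq> \<zero>\<^bsub>?Q\<^esub>} = I \<cdot> I +> (p \<otimes> f \<oplus> q \<otimes> g)"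
    if c: "{b. c b \<noteq> \<zero>\<^bsub>?Q\<^esub>} \<subseteq> {F, G}" and p: "p \<in> carrier R" "c F = I +> p"
      and q: "q \<in> carrier R" "c G = I +> q" for c p q
  proof -
    have cQ: "c F \<in> carrier ?Q" "c G \<in> carrier ?Q" using p q by (auto simp: FactRing_carrier_eq)
    have "finsum ?M (\<lambda>b. c b \<odot>\<^bsub>?M\<^esub> b) {b. c b \<noteq> \<zero>\<^bsub>?Q\<^esub>} = finsum ?M (\<lambda>b. c b \<odot>\<^bsub>?M\<^esub> b) {F, G}"
    proof (rule M.add.finprod_mono_neutral_cong_left)
      fix b assume "b \<in> {F, G} - {b. c b \<noteq> \<zero>\<^bsub>?Q\<^esub>}"
      thus "c b \<odot>\<^bsub>?M\<^esub> b = \<zero>\<^bsub>?M\<^esub>" using FG M.smult_l_null by auto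
    qed (use c cQ FG in auto)
    also have "\<dots> = c F \<odot>\<^bsub>?M\<^esub> F \<oplus>\<^bsub>?M\<^esub> c G \<odot>\<^bsub>?M\<^esub> G"
      using FneG cQ FG by (subst M.finsum_insert) (auto simp: M.finsum_insert)
    also have "\<dots> = I \<cdot> I +> (p \<otimes> f \<oplus> q \<otimes> g)"
      using p q fc gc
      by (simp add: conormal_module_simps F_def G_def mult f g I2.a_rcos_sum)
    finally show ?thesis .
  qed
  show ?thesis unfolding free_module_def
  proof (intro conjI exI[of _ "{F, G}"] ballI)
    show "Module.module ?Q ?M" by (rule M.module_axioms)
    show "{F, G} \<subseteq> carrier ?M" using FG by blast
    fix v assume "v \<in> carrier ?M"
    then obtain x where x: "x \<in> I" "v = I \<cdot> I +> x" by (auto simp: conormal_module_simps)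
    obtain p q where pq: "p \<in> carrier R" "q \<in> carrier R" "x = p \<otimes> f \<oplus> q \<otimes> g"
      using span[OF x(1)] by blast
    define c where "c = (\<lambda>b. if b = F then I +> p else if b = G then I +> q else I)"
    have cF: "c F = I +> p" and cG: "c G = I +> q" using FneG by (auto simp: c_def)
    have sub: "{b. c b \<noteq> \<zero>\<^bsub>?Q\<^esub>} \<subseteq> {F, G}" by (auto simp: c_def zeroQ)
    have zQ: "I \<in> carrier ?Q" using zeroQ M.R.zero_closed by simp
    show "\<exists>!c. (\<forall>b. c b \<in> carrier ?Q) \<and> finite {b. c b \<noteq> \<zero>\<^bsub>?Q\<^esub>} \<and> {b. c b \<noteq> \<zero>\<^bsub>?Q\<^esub>} \<subseteq> {F, G} \<and>
             v = finsum ?M (\<lambda>b. c b \<odot>\<^bsub>?M\<^esub> b) {b. c b \<noteq> \<zero>\<^bsub>?Q\<^esub>}"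
    proof (rule ex1I[of _ c], intro conjI allI)
      show "c b \<in> carrier ?Q" for b using pq zQ by (auto simp: c_def FactRing_carrier_eq)
      show "finite {b. c b \<noteq> \<zero>\<^bsub>?Q\<^esub>}" using sub by (rule finite_subset) simp
      show "v = finsum ?M (\<lambda>b. c b \<odot>\<^bsub>?M\<^esub> b) {b. c b \<noteq> \<zero>\<^bsub>?Q\<^esub>}"
        using comb[OF sub pq(1) cF pq(2) cG] x pq by simp
    next
      fix d assume d: "(\<forall>b. d b \<in> carrier ?Q) \<and> finite {b. d b \<noteq> \<zero>\<^bsub>?Q\<^esub>} \<and> {b. d b \<noteq> \<zero>\<^bsub>?Q\<^esub>} \<subseteq> {F, G} \<and>
             v = finsum ?M (\<lambda>b. d b \<odot>\<^bsub>?M\<^esub> b) {b. d b \<noteq> \<zero>\<^bsub>?Q\<^esub>}"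
      hence "d F \<in> (\<lambda>a. I +> a) ` carrier R" "d G \<in> (\<lambda>a. I +> a) ` carrier R"
        by (auto simp: FactRing_carrier_eq)
      then obtain p' q' where p'q': "p' \<in> carrier R" "d F = I +> p'" "q' \<in> carrier R" "d G = I +> q'"
        by blast
      have "I \<cdot> I +> (p' \<otimes> f \<oplus> q' \<otimes> g) = I \<cdot> I +> (p \<otimes> f \<oplus> q \<otimes> g)"
        using comb[of d p' q'] d p'q' x pq by simp
      hence "(p' \<otimes> f \<oplus> q' \<otimes> g) \<ominus> (p \<otimes> f \<oplus> q \<otimes> g) \<in> I \<cdot> I"
        using I2.rcos_eq_iff pq p'q' fc gc by simp
      moreover have "(p' \<otimes> f \<oplus> q' \<otimes> g) \<ominus> (p \<otimes> f \<oplus> q \<otimes> g) = (p' \<ominus> p) \<otimes> f \<oplus> (q' \<ominus> q) \<otimes> g"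
        using fc gc pq p'q' by algebra
      ultimately have "p' \<ominus> p \<in> I" "q' \<ominus> q \<in> I" using indep[of "p' \<ominus> p" "q' \<ominus> q"] pq p'q' by auto
      hence "d F = c F" "d G = c G" using p'q' pq I.rcos_eq_iff cF cG by auto
      moreover have "d b = I" if "b \<noteq> F" "b \<noteq> G" for b using d that by (auto simp: zeroQ)
      ultimately show "d = c" by (auto simp: c_def fun_eq_iff)
    qed (use sub in auto)
  qed
qed

text \<open>
  The submodules of \<open>R/I\<close> are the images of the ideals that contain \<open>I\<close>; chains of submodules thus
  become chains of ideals.
\<close>

lemma (in cring) submodule_cyclic_vimage:
  assumes I: "ideal I R" and N: "submodule N R (cyclic_module R I)"
  shows "ideal {x \<in> carrier R. I +> x \<in> N} R" and "I \<subseteq> {x \<in> carrier R. I +> x \<in> N}"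
    and "N = (\<lambda>x. I +> x) ` {x \<in> carrier R. I +> x \<in> N}"
proof -
  interpret I: ideal I R by fact
  interpret N: submodule N R "cyclic_module R I" by fact
  let ?J = "{x \<in> carrier R. I +> x \<in> N}"
  have ops: "carrier (cyclic_module R I) = (\<lambda>x. I +> x) ` carrier R"
    "add (cyclic_module R I) = set_add R" "zero (cyclic_module R I) = I"
    "\<And>a X. smult (cyclic_module R I) a X = rcoset_mult R I (I +> a) X"
    by (simp_all add: cyclic_module_def FactRing_ops FactRing_carrier_eq)
  have add: "x \<oplus> y \<in> ?J" if "x \<in> ?J" "y \<in> ?J" for x y
    using that N.m_closed[of "I +> x" "I +> y"] by (simp add: ops I.a_rcos_sum)
  have mult: "a \<otimes> x \<in> ?J" if "x \<in> ?J" "a \<in> carrier R" for a x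
    using that N.smult_closed[of a "I +> x"] by (simp add: ops I.rcoset_mult_add)
  have "I \<in> N" using N.one_closed by (simp add: ops)
  thus sub: "I \<subseteq> ?J" using I.a_rcos_const I.Icarr by auto
  show "ideal ?J R"
  proof (rule idealI[OF ring_axioms])
    show "subgroup ?J (add_monoid R)"
    proof (rule add.subgroupI)
      show "?J \<noteq> {}" using sub I.zero_closed by blast
      show "\<ominus> a \<in> ?J" if "a \<in> ?J" for a
      proof -
        have "\<ominus> a = (\<ominus> \<one>) \<otimes> a" using that by (simp add: l_minus)
        thus ?thesis using mult[OF that, of "\<ominus> \<one>"] by simp
      qed
    qed (use add in auto)
  qed (use mult m_comm in auto)
  show "N = (\<lambda>x. I +> x) ` ?J" using N.subset by (auto simp: ops)
qed

lemma (in cring) submodule_cyclic_image: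
  assumes I: "ideal I R" and J: "ideal J R"
  shows "submodule ((\<lambda>x. I +> x) ` J) R (cyclic_module R I)"
proof -
  interpret I: ideal I R by fact
  interpret J: ideal J R by fact
  interpret Q: ideal "(\<lambda>x. I +> x) ` J" "R Quot I" by (rule ring_ideal_imp_quot_ideal[OF I J])
  have "m_inv (add_monoid (cyclic_module R I)) = m_inv (add_monoid (R Quot I))"
    by (simp add: m_inv_def fun_eq_iff cyclic_module_def)
  hence sg: "subgroup ((\<lambda>x. I +> x) ` J) (add_monoid (cyclic_module R I))"
    using Q.a_subgroup by (simp add: subgroup_def cyclic_module_def)
  show ?thesis
  proof (rule submodule.intro[OF sg], unfold_locales)
    fix a x assume "a \<in> carrier R" "x \<in> (\<lambda>x. I +> x) ` J"
    thus "a \<odot>\<^bsub>cyclic_module R I\<^esub> x \<in> (\<lambda>x. I +> x) ` J"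
      using J.Icarr by (auto simp: cyclic_module_def FactRing_ops I.rcoset_mult_add J.I_l_closed)
  qed
qed

section \<open>Orders of power series\<close>

lemma fps_X_power_dvd_iff:
  "fps_X ^ n dvd (f :: 'k::field fps) \<longleftrightarrow> (\<forall>m<n. f $ m = 0)"
proof
  assume "fps_X ^ n dvd f"
  thus "\<forall>m<n. f $ m = 0" by (auto elim!: dvdE simp: fps_X_power_mult_nth)
next
  assume "\<forall>m<n. f $ m = 0"
  hence "f = fps_X ^ n * fps_shift n f" by (intro fps_ext) (simp add: fps_X_power_mult_nth)
  thus "fps_X ^ n dvd f" by (metis dvd_triv_left)
qed

lemma fps_X_power_dvd_iff_subdegree:
  "fps_X ^ n dvd (f :: 'k::field fps) \<longleftrightarrow> f = 0 \<or> n \<le> subdegree f"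
  by (cases "f = 0") (simp_all add: fps_dvd_iff)

text \<open>
  This reads off the order of a quotient from a division with a remainder of high order.
\<close>

lemma subdegree_eq_of_dvd_diff:
  fixes u f h :: "'k::field fps"
  assumes "fps_X ^ N dvd u - f * h" "u \<noteq> 0" "subdegree u < N"
  shows "h \<noteq> 0" and "subdegree f + subdegree h = subdegree u"
proof -
  have eq: "(f * h) $ m = u $ m" if "m < N" for m
    using assms(1) that by (simp add: fps_X_power_dvd_iff)
  have nz: "f * h \<noteq> 0" using eq[OF assms(3)] assms(2) by (metis fps_zero_nth nth_subdegree_zero_iff)
  thus "h \<noteq> 0" by auto
  have "subdegree (f * h) = subdegree u"
  proof (rule subdegreeI)
    show "(f * h) $ subdegree u \<noteq> 0" unfolding eq[OF assms(3)] using assms(2) by simp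
    show "(f * h) $ i = 0" if "i < subdegree u" for i
      using eq[of i] that assms(3) by (simp only: nth_less_subdegree_zero)
  qed
  thus "subdegree f + subdegree h = subdegree u" using nz by auto
qed

text \<open>
  Power series division by several divisors at once: the unknown coefficients \<open>x\<^sub>n\<close> satisfy
  a lower triangular linear system with nonzero diagonal, hence are found recursively.
\<close>

lemma ex_combination_with_prescribed_coeffs:
  fixes e :: "nat \<Rightarrow> 'k::field fps" and c d :: "nat \<Rightarrow> _"
  assumes "q > 0"
    and ne: "\<And>r. r < q \<Longrightarrow> e r \<noteq> 0"
    and sub: "\<And>r. r < q \<Longrightarrow> subdegree (e r) = d r"
    and dmod: "\<And>r. r < q \<Longrightarrow> d r mod q = r"
  shows "\<exists>P. (\<forall>r m. \<not> q dvd m \<longrightarrow> P r $ m = 0) \<and>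
           (\<forall>m<N. (\<Sum>r<q. P r * e r) $ m = 0) \<and>
           (\<forall>n\<ge>N. d (n mod q) \<le> n \<longrightarrow> (\<Sum>r<q. P r * e r) $ n = c n)"
proof -
  define P :: "(nat \<Rightarrow> 'k) \<Rightarrow> nat \<Rightarrow> 'k fps"
    where "P x r = Abs_fps (\<lambda>m. if q dvd m then x (m + d r) else 0)" for x r
  define \<Phi> where "\<Phi> x = (\<Sum>r<q. P x r * e r)" for x
  define lead where "lead n = e (n mod q) $ d (n mod q)" for n
  have lead: "lead n \<noteq> 0" for n
    using ne[of "n mod q"] sub[of "n mod q"] \<open>q > 0\<close> by (simp add: lead_def flip: sub)
  have \<Phi>_add: "\<Phi> (\<lambda>m. x m + y m) = \<Phi> x + \<Phi> y" for x y
  proof -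
    have "P (\<lambda>m. x m + y m) r = P x r + P y r" for r by (rule fps_ext) (simp add: P_def)
    thus ?thesis by (simp add: \<Phi>_def distrib_right sum.distrib)
  qed
  \<comment> \<open>The term \<open>P x r * e r\<close> meets exponent \<open>n\<close> at its leading term only if \<open>r = n mod q\<close>.\<close>
  have \<Phi>_diag: "\<Phi> x $ n = (if d (n mod q) \<le> n then x n * lead n else 0)"
    if x: "\<And>m. m < n \<Longrightarrow> x m = 0" for x n
  proof -
    have term0: "P x r $ i * e r $ (n - i) = 0"
      if "r < q" "i \<le> n" "\<not> (r = n mod q \<and> i + d r = n)" for r i
    proof (rule ccontr)
      assume nz: "P x r $ i * e r $ (n - i) \<noteq> 0"
      hence "q dvd i" "x (i + d r) \<noteq> 0" by (auto simp: P_def split: if_splits)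
      moreover have "d r \<le> n - i"
        using nz sub[OF that(1)] by (metis mult_zero_right not_less nth_less_subdegree_zero)
      ultimately have "i + d r = n" using x[of "i + d r"] that(2) by linarith
      moreover from this \<open>q dvd i\<close> have "n mod q = r" using dmod[OF that(1)]
        by (auto elim!: dvdE)
      ultimately show False using that(3) by simp
    qed
    define r where "r = n mod q"
    have r: "r < q" using \<open>q > 0\<close> by (simp add: r_def)
    have "(P x s * e s) $ n = 0" if "s < q" "s \<noteq> r" for s
      unfolding fps_mult_nth using that term0[of s] by (intro sum.neutral) (auto simp: r_def)
    hence "\<Phi> x $ n = (P x r * e r) $ n"
      using r by (simp add: \<Phi>_def fps_sum_nth sum.remove[of "{..<q}" r])
    also have "\<dots> = (if d r \<le> n then x n * lead n else 0)"
    proof (cases "d r \<le> n")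
      case True
      have "q dvd n - d r" using dmod[OF r] True mod_eq_dvd_iff_nat[of "d r" n q] by (simp add: r_def)
      hence "P x r $ (n - d r) * e r $ d r = x n * lead n"
        using True by (simp add: P_def lead_def r_def)
      moreover have "P x r $ i * e r $ (n - i) = 0" if "i \<in> {0..n} - {n - d r}" for i
        using that r True by (intro term0) auto
      hence "(P x r * e r) $ n = P x r $ (n - d r) * e r $ (n - (n - d r))"
        unfolding fps_mult_nth by (subst sum.remove[of _ "n - d r"]) (simp_all add: sum.neutral)
      ultimately show ?thesis using True by simp
    next
      case False
      thus ?thesis unfolding fps_mult_nth using r term0[of r] by (auto intro!: sum.neutral)
    qed
    finally show ?thesis by (simp add: r_def)
  qed
  define below :: "nat \<Rightarrow> (nat \<Rightarrow> 'k) \<Rightarrow> nat \<Rightarrow> 'k" where "below n x m = (if m < n then x m else 0)" for n x m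
  define step where "step x n = (if N \<le> n then (c n - \<Phi> (below n x) $ n) / lead n else 0)" for x n
  have "adm_wf less_than step"
  proof (unfold adm_wf_def, intro allI impI)
    fix x y :: "nat \<Rightarrow> 'k" and n assume "\<forall>z. (z, n) \<in> less_than \<longrightarrow> x z = y z"
    hence "below n x = below n y" by (auto simp: below_def)
    thus "step x n = step y n" by (simp add: step_def)
  qed
  define x where "x = wfrec less_than step"
  have x: "x = step x"
    unfolding x_def by (rule wfrec_fixpoint[OF wf_less_than \<open>adm_wf less_than step\<close>])
  have "\<Phi> x $ m = 0" if "m < N" for m
  proof -
    have "x j = 0" if "j < N" for j using that fun_cong[OF x, of j] by (simp add: step_def)
    with that show ?thesis by (subst \<Phi>_diag) auto
  qed
  moreover have "\<Phi> x $ n = c n" if n: "N \<le> n" "d (n mod q) \<le> n" for n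
  proof -
    define y where "y m = (if m < n then 0 else x m)" for m
    have "x = (\<lambda>m. below n x m + y m)" by (auto simp: below_def y_def)
    hence "\<Phi> x = \<Phi> (below n x) + \<Phi> y" using \<Phi>_add[of "below n x" y] by simp
    hence "\<Phi> x $ n = \<Phi> (below n x) $ n + \<Phi> y $ n" by simp
    also have "\<Phi> y $ n = x n * lead n" using n by (subst \<Phi>_diag) (auto simp: y_def)
    also have "x n = (c n - \<Phi> (below n x) $ n) / lead n"
      using n fun_cong[OF x, of n] by (simp add: step_def)
    finally show ?thesis using lead[of n] by simp
  qed
  ultimately show ?thesis
    by (intro exI[of _ "P x"]) (simp add: \<Phi>_def, simp add: P_def)
qed

section \<open>The ring \<open>k[[t\<^sup>5,t\<^sup>1\<^sup>1]]\<close> and its ideals\<close>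

text \<open>
  As \<open>11 \<equiv> 1\<close> modulo 5, the least element of the semigroup in the residue class of \<open>r < 5\<close> is \<open>11 r\<close>.
\<close>

lemma mem_semigroup_5_11: "n \<in> semigroup_5_11 \<longleftrightarrow> 11 * (n mod 5) \<le> n"
proof
  assume "n \<in> semigroup_5_11"
  then obtain i j where n: "n = 5 * i + 11 * j" by (auto simp: semigroup_5_11_def)
  hence "n = j + 5 * (i + 2 * j)" by simp
  hence "n mod 5 = j mod 5" by (metis mod_mult_self2)
  also have "\<dots> \<le> j" by simp
  finally show "11 * (n mod 5) \<le> n" using n by linarith
next
  assume *: "11 * (n mod 5) \<le> n"
  hence "n = 5 * (n div 5 - 2 * (n mod 5)) + 11 * (n mod 5)"
    using div_mult_mod_eq[of n 5] by linarith
  thus "n \<in> semigroup_5_11" unfolding semigroup_5_11_def by blast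
qed

declare semigroup_ring_simps(1) [simp del]

abbreviation A511 :: "'k::field fps ring" where
  "A511 \<equiv> semigroup_ring semigroup_5_11"

interpretation A511: cring "A511 :: 'k::field fps ring"
  by (rule cring_semigroup_ring) (fact semigroup_5_11_closed)+

lemma A511_iff: "f \<in> carrier A511 \<longleftrightarrow> (\<forall>n. f $ n \<noteq> 0 \<longrightarrow> 11 * (n mod 5) \<le> n)"
  by (simp add: semigroup_ring_simps(1) mem_semigroup_5_11)

lemma A511_nth_eq_0: "f \<in> carrier A511 \<Longrightarrow> n < 11 * (n mod 5) \<Longrightarrow> f $ n = 0"
  by (auto simp: A511_iff)

lemma A511_closed [simp, intro]:
  fixes p q :: "'k::field fps"
  assumes "p \<in> carrier A511" "q \<in> carrier A511"
  shows A511_add: "p + q \<in> carrier A511" and A511_mult: "p * q \<in> carrier A511"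
    and A511_uminus: "- p \<in> carrier A511" and A511_diff: "p - q \<in> carrier A511"
proof -
  show "p + q \<in> carrier A511" "p * q \<in> carrier A511"
    using A511.a_closed[of p q] A511.m_closed[of p q] assms by simp_all
  show "- p \<in> carrier A511" using assms(1) by (simp add: A511_iff)
  show "p - q \<in> carrier A511" using assms by (auto simp: A511_iff) (metis diff_zero)
qed

lemma A511_const [simp, intro]: "fps_const c \<in> carrier A511"
  by (auto simp: A511_iff split: if_splits)

lemma A511_one_zero [simp, intro]: "1 \<in> carrier A511" "0 \<in> carrier A511"
  by (auto simp: A511_iff)

lemma A511_X_power [simp, intro]: "11 * (n mod 5) \<le> n \<Longrightarrow> fps_X ^ n \<in> carrier A511"
  by (auto simp: A511_iff split: if_splits)

lemma A511_conductor: "fps_X ^ 40 dvd f \<Longrightarrow> f \<in> carrier A511"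
proof -
  have "11 * (n mod 5) \<le> n" if "40 \<le> n" for n :: nat
  proof (cases "44 \<le> n")
    case False
    with that have "n = 40 \<or> n = 41 \<or> n = 42 \<or> n = 43" by linarith
    thus ?thesis by auto
  qed (use mod_less_divisor[of 5 n] in linarith)
  thus "fps_X ^ 40 dvd f \<Longrightarrow> f \<in> carrier A511" by (auto simp: A511_iff fps_X_power_dvd_iff not_less[symmetric])
qed

lemma A511_inverse [intro]: "f \<in> carrier A511 \<Longrightarrow> f $ 0 \<noteq> 0 \<Longrightarrow> inverse f \<in> carrier A511"
  using semigroup_ring_inverse semigroup_5_11_closed by blast

lemma A511_dvd_X5:
  fixes f :: "'k::field fps"
  assumes "f \<in> carrier A511" "f $ 0 = 0" shows "fps_X ^ 5 dvd f"
proof -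
  have "f $ m = 0" if "m < 5" for m
  proof (cases "m = 0")
    case False
    hence "m < 11 * (m mod 5)" using that by simp
    thus ?thesis using A511_nth_eq_0 assms by blast
  qed (use assms in simp)
  thus ?thesis by (simp add: fps_X_power_dvd_iff)
qed

lemma A511_subdegree: "f \<in> carrier A511 \<Longrightarrow> 11 * (subdegree f mod 5) \<le> subdegree f"
  by (cases "f = 0") (auto simp: A511_iff)

lemma A511_a_inv [simp]: "x \<in> carrier A511 \<Longrightarrow> \<ominus>\<^bsub>A511\<^esub> x = - x"
  using A511.l_neg[of x] by (simp add: eq_neg_iff_add_eq_0)

lemma A511_minus [simp]:
  "x \<in> carrier A511 \<Longrightarrow> y \<in> carrier A511 \<Longrightarrow> x \<ominus>\<^bsub>A511\<^esub> y = x - y"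
  by (simp add: a_minus_def)

lemma genideal_A511_pair:
  "f \<in> carrier A511 \<Longrightarrow> g \<in> carrier A511 \<Longrightarrow>
   genideal A511 {f, g} = {p * f + q * g | p q. p \<in> carrier A511 \<and> q \<in> carrier A511}"
  using A511.genideal_pair[of f g] by simp

lemma genideal_A511_single:
  "f \<in> carrier A511 \<Longrightarrow> genideal A511 {f} = {p * f | p. p \<in> carrier A511}"
  using A511.cgenideal_eq_genideal[of f] by (simp add: cgenideal_def)

lemma ideal_A511:
  fixes J :: "'k::field fps set"
  assumes "ideal J A511"
  shows ideal_A511_carrier: "x \<in> J \<Longrightarrow> x \<in> carrier A511"
    and ideal_A511_zero: "0 \<in> J"
    and ideal_A511_add: "x \<in> J \<Longrightarrow> y \<in> J \<Longrightarrow> x + y \<in> J"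
    and ideal_A511_mult: "x \<in> J \<Longrightarrow> p \<in> carrier A511 \<Longrightarrow> p * x \<in> J"
    and ideal_A511_uminus: "x \<in> J \<Longrightarrow> - x \<in> J"
    and ideal_A511_diff: "x \<in> J \<Longrightarrow> y \<in> J \<Longrightarrow> x - y \<in> J"
proof -
  interpret ideal J A511 by fact
  show "x \<in> J \<Longrightarrow> x \<in> carrier A511" for x by (rule Icarr)
  show "0 \<in> J" using zero_closed by simp
  show a: "x \<in> J \<Longrightarrow> y \<in> J \<Longrightarrow> x + y \<in> J" for x y using a_closed[of x y] by simp
  show "x \<in> J \<Longrightarrow> p \<in> carrier A511 \<Longrightarrow> p * x \<in> J" for x p using I_l_closed[of x p] by simp
  show m: "x \<in> J \<Longrightarrow> - x \<in> J" for x using a_inv_closed[of x] Icarr[of x] by simp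
  show "x \<in> J \<Longrightarrow> y \<in> J \<Longrightarrow> x - y \<in> J" using a[of x "- y"] m[of y] by simp
qed

text \<open>
  Every proper ideal that contains a power of \<open>t\<close> times \<open>V\<close> is primary to the maximal ideal: a
  nonunit has positive order, so a high power of it lies in the ideal, and units can be cancelled.
\<close>

lemma primary_to_max_ideal_A511:
  fixes J :: "'k::field fps set"
  assumes J: "ideal J A511" and one: "1 \<notin> J" and pow: "\<And>x. fps_X ^ N dvd x \<Longrightarrow> x \<in> J"
  shows "primary_to A511 (max_ideal A511) J"
proof -
  have max: "max_ideal A511 = {f \<in> carrier A511. f $ 0 = (0::'k)}"
    by (rule local_ring_semigroup_ring) (fact semigroup_5_11_closed)+
  have pow_eq: "x [^]\<^bsub>A511\<^esub> n = x ^ n" for x :: "'k fps" and n :: nat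
    by (induction n) (simp_all add: mult.commute)
  have unit: "b \<in> J" if "a \<in> carrier A511" "a $ 0 \<noteq> 0" "a * b \<in> J" for a b
  proof -
    have "inverse a * (a * b) \<in> J" 
      by (rule ideal_A511_mult[OF J that(3) A511_inverse[OF that(1,2)]])
    moreover have "inverse a * (a * b) = b"
      using inverse_mult_eq_1[OF that(2)] by (simp only: mult.assoc[symmetric] mult_1_left)
    ultimately show ?thesis by simp
  qed
  have rad: "radical_of A511 J = max_ideal A511"
  proof (intro equalityI subsetI)
    fix x :: "'k fps" assume "x \<in> radical_of A511 J"
    then obtain n where x: "x \<in> carrier A511" "x ^ n \<in> J" by (auto simp: radical_of_def pow_eq)
    have "x $ 0 = 0"
    proof (rule ccontr)
      assume nz: "x $ 0 \<noteq> 0"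
      have "x ^ n \<in> carrier A511" using x J ideal_A511_carrier by blast
      moreover have "(x ^ n) $ 0 \<noteq> 0" using nz by (simp add: fps_nth_power_0)
      ultimately have "1 \<in> J" using unit[of "x ^ n" 1] x by simp
      with one show False by blast
    qed
    with x show "x \<in> max_ideal A511" by (simp add: max)
  next
    fix x :: "'k fps" assume x: "x \<in> max_ideal A511"
    hence "fps_X ^ 1 dvd x" unfolding fps_X_power_dvd_iff by (simp add: max)
    hence "fps_X ^ N dvd x ^ N" by (simp add: dvd_power_same)
    with pow have "x ^ N \<in> J" by blast
    with x show "x \<in> radical_of A511 J" by (auto simp: radical_of_def pow_eq max)
  qed
  have "primary_ideal A511 J" unfolding primary_ideal_def rad
  proof (intro conjI ballI impI)
    show "J \<noteq> carrier A511" using one by blast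
    fix a b assume "a \<in> carrier A511" "b \<in> carrier A511" "a \<otimes>\<^bsub>A511\<^esub> b \<in> J"
    thus "a \<in> J \<or> b \<in> max_ideal A511" using unit[of b a] by (auto simp: max mult.commute)
  qed fact
  with rad show ?thesis by (simp add: primary_to_def)
qed

text \<open>
  Two nested ideals with the same orders of elements coincide: an element of the larger one is
  reduced by elements of the smaller one, which raises its order, until it is absorbed by
  \<open>t\<^sup>N V\<close>. This is what bounds the length of a chain by a number of exponents.
\<close>

lemma ideal_eqI_subdegree:
  fixes J K :: "'k::field fps set"
  assumes J: "ideal J A511" and K: "ideal K A511" and "J \<subseteq> K"
    and big: "\<And>x. fps_X ^ N dvd x \<Longrightarrow> x \<in> J"
    and vals: "\<And>x. x \<in> K \<Longrightarrow> x \<noteq> 0 \<Longrightarrow> \<exists>y\<in>J. y \<noteq> 0 \<and> subdegree y = subdegree x"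
  shows "J = K"
proof
  have "x \<in> J" if "x \<in> K" for x using that
  proof (induction "N - subdegree x" arbitrary: x rule: less_induct)
    case less
    show ?case
    proof (cases "x = 0 \<or> N \<le> subdegree x")
      case True
      hence "fps_X ^ N dvd x" by (simp add: fps_X_power_dvd_iff_subdegree)
      thus ?thesis by (rule big)
    next
      case False
      then obtain y where y: "y \<in> J" "y \<noteq> 0" "subdegree y = subdegree x" using vals less.prems by blast
      have yn: "y $ subdegree x \<noteq> 0" using nth_subdegree_nonzero[OF y(2)] y(3) by simp
      define a where "a = fps_const (x $ subdegree x / y $ subdegree x)"
      have ay: "a * y \<in> J" using ideal_A511_mult[OF J y(1)] by (simp add: a_def)
      have K': "x - a * y \<in> K" using ideal_A511_diff[OF K less.prems] ay \<open>J \<subseteq> K\<close> by blast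
      have "x - a * y \<in> J"
      proof (cases "x - a * y = 0")
        case True
        thus ?thesis using ideal_A511_zero[OF J] by simp
      next
        case nz: False
        have "(x - a * y) $ m = 0" if "m \<le> subdegree x" for m
        proof (cases "m = subdegree x")
          case True
          thus ?thesis using yn by (simp add: a_def)
        next
          case False
          with that have "m < subdegree x" by simp
          hence "x $ m = 0" "y $ m = 0" using y(3) by (simp_all only: nth_less_subdegree_zero)
          thus ?thesis by (simp add: a_def)
        qed
        hence "subdegree x < subdegree (x - a * y)" by (intro subdegree_greaterI[OF nz]) blast
        thus ?thesis using False by (intro less.hyps K') linarith
      qed
      hence "x - a * y + a * y \<in> J" using ay by (rule ideal_A511_add[OF J])
      thus ?thesis by simp
    qed
  qed
  thus "K \<subseteq> J" by blast
qed fact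

section \<open>The ideal of a pair of orders 20 and 26\<close>

text \<open>
  The condition \<open>g\<^sup>2 \<in> f I\<close> is imposed up to order 60 only. It then holds exactly
  (\<open>square_in\<close>), but for an explicit pair of generators the truncated form is a finite computation.
\<close>

locale ulrich_pair =
  fixes f g \<alpha> \<beta> :: "'k::field fps"
  assumes carr: "f \<in> carrier A511" "g \<in> carrier A511" "\<alpha> \<in> carrier A511" "\<beta> \<in> carrier A511"
    and subdegree_f: "subdegree f = 20" and subdegree_g: "subdegree g = 26"
    and rel: "fps_X ^ 60 dvd g * g - f * (\<alpha> * f + \<beta> * g)"
begin

definition I :: "'k fps set" where
  "I = {p * f + q * g | p q. p \<in> carrier A511 \<and> q \<in> carrier A511}"

lemma I_eq: "I = genideal A511 {f, g}"
  using genideal_A511_pair[OF carr(1,2)] by (simp add: I_def)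

lemma ideal_I: "ideal I A511"
  unfolding I_eq using carr by (intro A511.genideal_ideal) auto

lemmas I_carrier = ideal_A511_carrier[OF ideal_I]
  and I_zero = ideal_A511_zero[OF ideal_I]
  and I_add = ideal_A511_add[OF ideal_I]
  and I_diff = ideal_A511_diff[OF ideal_I]
  and I_mult = ideal_A511_mult[OF ideal_I]

lemma I_memI: "p \<in> carrier A511 \<Longrightarrow> q \<in> carrier A511 \<Longrightarrow> p * f + q * g \<in> I"
  by (auto simp: I_def)

lemma f_in_I: "f \<in> I" and g_in_I: "g \<in> I"
  using I_memI[of 1 0] I_memI[of 0 1] by auto

lemma nonzero: "f \<noteq> 0" "g \<noteq> 0"
  using subdegree_f subdegree_g by auto

text \<open>
  Dividing \<open>g\<^sup>2, g\<^sup>3, g\<^sup>4\<close> by powers of \<open>f\<close>, up to terms of high order, produces elements of \<open>I\<close>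
  of orders 32, 38 and 44. The error terms stay negligible because \<open>\<beta>\<close> is a nonunit: otherwise
  \<open>\<alpha> f\<close> would have order 26, although 6 is a gap.
\<close>

lemma ex_five_orders: "\<exists>e. \<forall>r<5. e r \<in> I \<and> e r \<noteq> 0 \<and> subdegree (e r) = 20 + 6 * r"
proof -
  define h2 where "h2 = \<alpha> * f + \<beta> * g"
  define h3 where "h3 = \<alpha> * g + \<beta> * h2"
  define h4 where "h4 = \<alpha> * h2 + \<beta> * h3"
  define E where "E = g * g - f * h2"
  have E: "fps_X ^ 60 dvd E" using rel by (simp add: E_def h2_def)
  have h2: "h2 \<noteq> 0" "subdegree h2 = 32"
    using subdegree_eq_of_dvd_diff[of 60 "g * g" f h2] E nonzero subdegree_f subdegree_g
    by (auto simp: E_def)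
  have "g * h2 - f * h3 = \<beta> * E" by (simp add: h3_def h2_def E_def algebra_simps)
  hence e3: "fps_X ^ 60 dvd g * h2 - f * h3" using E by simp
  have h3: "h3 \<noteq> 0" "subdegree h3 = 38"
    using subdegree_eq_of_dvd_diff[OF e3] h2 nonzero subdegree_f subdegree_g by auto
  have "\<beta> $ 0 = 0"
  proof (rule ccontr)
    assume "\<beta> $ 0 \<noteq> 0"
    hence "\<beta> \<noteq> 0" "subdegree \<beta> = 0" by auto
    hence b: "\<beta> * g \<noteq> 0" "subdegree (\<beta> * g) = 26" using nonzero subdegree_g by auto
    have af: "\<alpha> * f = h2 - \<beta> * g" by (simp add: h2_def)
    have s: "subdegree (\<alpha> * f) = 26" unfolding af using b h2 by (subst subdegree_diff_eq2) auto
    hence "\<alpha> * f \<noteq> 0" by auto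
    with s have "subdegree \<alpha> = 6" using subdegree_f by auto
    thus False using A511_subdegree[OF carr(3)] by simp
  qed
  hence "fps_X ^ 5 dvd \<beta>" using A511_dvd_X5 carr by blast
  hence "fps_X ^ 5 * (fps_X ^ 5 * fps_X ^ 60) dvd \<beta> * (\<beta> * E)" using E by (intro mult_dvd_mono)
  moreover have "h2 * h2 - f * h4 = \<beta> * (\<beta> * E)"
    by (simp add: h4_def h3_def h2_def E_def algebra_simps)
  ultimately have e4: "fps_X ^ 70 dvd h2 * h2 - f * h4" by (simp flip: power_add)
  have h4: "h4 \<noteq> 0" "subdegree h4 = 44"
    using subdegree_eq_of_dvd_diff[OF e4] h2 nonzero subdegree_f by auto
  have I2: "h2 \<in> I" unfolding h2_def using carr by (intro I_memI)
  have I3: "h3 \<in> I" unfolding h3_def using carr I2 g_in_I by (intro I_add I_mult)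
  have I4: "h4 \<in> I" unfolding h4_def using carr I2 I3 by (intro I_add I_mult)
  have r5: "r < 5 \<longleftrightarrow> r = 0 \<or> r = 1 \<or> r = 2 \<or> r = 3 \<or> r = 4" for r :: nat by linarith
  show ?thesis
    by (rule exI[of _ "\<lambda>r. [f, g, h2, h3, h4] ! r"])
      (use h2 h3 h4 I2 I3 I4 f_in_I g_in_I nonzero subdegree_f subdegree_g in \<open>auto simp: r5\<close>)
qed

text \<open>
  The exponents \<open>n\<close> with \<open>20 + 6 * (n mod 5) \<le> n\<close> are \<open>20 + \<langle>5,6\<rangle>\<close>, because \<open>20 + 6 r\<close> is the least
  one in the residue class of \<open>r\<close> modulo 5. Multiplying the five elements above by power series in
  \<open>t\<^sup>5\<close> gives elements of \<open>I\<close> whose coefficients at these exponents are arbitrary.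
\<close>

lemma ex_prescribed:
  "\<exists>i\<in>I. (\<forall>m<N. i $ m = 0) \<and> (\<forall>n\<ge>N. 20 + 6 * (n mod 5) \<le> n \<longrightarrow> i $ n = c n)"
proof -
  obtain e where e: "\<And>r. r < 5 \<Longrightarrow> e r \<in> I \<and> e r \<noteq> 0 \<and> subdegree (e r) = 20 + 6 * r"
    using ex_five_orders by blast
  have d: "(20 + 6 * r) mod 5 = r" if "r < 5" for r :: nat
  proof -
    have "20 + 6 * r = r + 5 * (4 + r)" by simp
    thus ?thesis using that by (metis mod_less mod_mult_self2)
  qed
  obtain P where P: "\<And>r m. \<not> 5 dvd m \<Longrightarrow> P r $ m = 0"
    and Pe: "\<forall>m<N. (\<Sum>r<5. P r * e r) $ m = 0"
      "\<forall>n\<ge>N. 20 + 6 * (n mod 5) \<le> n \<longrightarrow> (\<Sum>r<5. P r * e r) $ n = c n"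
    using ex_combination_with_prescribed_coeffs[of 5 e "\<lambda>r. 20 + 6 * r" N c] e d by auto
  have "P r \<in> carrier A511" for r
    unfolding A511_iff using P by (metis dvd_imp_mod_0 mult_0_right zero_le)
  hence "(\<Sum>r<m. P r * e r) \<in> I" if "m \<le> 5" for m
    using that by (induction m) (auto intro!: I_add I_mult I_zero simp: e)
  from this[of 5] show ?thesis using Pe by (intro bexI[of _ "\<Sum>r<5. P r * e r"]) auto
qed

lemma ex_order:
  assumes "20 + 6 * (n mod 5) \<le> n"
  shows "\<exists>i\<in>I. i \<noteq> 0 \<and> subdegree i = n"
proof -
  obtain i where i: "i \<in> I" "\<forall>m<n. i $ m = 0" "i $ n = 1"
    using ex_prescribed[of n "\<lambda>_. 1"] assms by blast
  moreover from i have "subdegree i = n" by (intro subdegreeI) auto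
  ultimately show ?thesis by (metis fps_zero_nth zero_neq_one)
qed

lemma conductor_subset: "fps_X ^ 40 dvd x \<Longrightarrow> x \<in> I"
proof -
  assume x: "fps_X ^ 40 dvd x"
  obtain i where i: "i \<in> I" "\<forall>m<40. i $ m = 0" "\<forall>n\<ge>40. 20 + 6 * (n mod 5) \<le> n \<longrightarrow> i $ n = x $ n"
    using ex_prescribed by blast
  have le: "20 + 6 * (n mod 5) \<le> n" if "40 \<le> n" for n :: nat
  proof (cases "44 \<le> n")
    case False
    with that have "n = 40 \<or> n = 41 \<or> n = 42 \<or> n = 43" by linarith
    thus ?thesis by auto
  qed (use mod_less_divisor[of 5 n] in linarith)
  have "x = i"
  proof (rule fps_ext)
    show "x $ n = i $ n" for n
      using i le[of n] x by (cases "n < 40") (auto simp: fps_X_power_dvd_iff)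
  qed
  with i show "x \<in> I" by simp
qed

text \<open>
  Above 33 the exponents of the semigroup all lie in \<open>20 + \<langle>5,6\<rangle>\<close>.
\<close>

lemma order_34_subset:
  assumes x: "fps_X ^ 34 dvd x" "x \<in> carrier A511" shows "x \<in> I"
proof -
  obtain i where i: "i \<in> I" "\<forall>m<34. i $ m = 0" "\<forall>n\<ge>34. 20 + 6 * (n mod 5) \<le> n \<longrightarrow> i $ n = x $ n"
    using ex_prescribed by blast
  have "(x - i) $ m = 0" if "m < 40" for m
  proof (cases "m < 34")
    case False
    with that have "m = 34 \<or> m = 35 \<or> m = 36 \<or> m = 37 \<or> m = 38 \<or> m = 39" by linarith
    thus ?thesis using i(3) A511_nth_eq_0[OF x(2), of m] A511_nth_eq_0[OF I_carrier[OF i(1)], of m]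
      by auto
  qed (use x i in \<open>auto simp: fps_X_power_dvd_iff\<close>)
  hence "x - i + i \<in> I" by (intro I_add i(1) conductor_subset) (simp add: fps_X_power_dvd_iff)
  thus ?thesis by simp
qed

text \<open>
  The error term, of order at least 60, is \<open>f\<close> times an element of \<open>t\<^sup>4\<^sup>0 V \<subseteq> I\<close>.
\<close>

lemma square_in: "\<exists>j\<in>I. g * g = f * j"
proof -
  obtain w where w: "g * g - f * (\<alpha> * f + \<beta> * g) = fps_X ^ 60 * w" using rel by blast
  define u where "u = fps_shift 20 f"
  have u: "f = fps_X ^ 20 * u" "u $ 0 \<noteq> 0"
    using fps_shift_times_fps_X_power[of 20 f] nth_subdegree_nonzero[OF nonzero(1)]
    by (simp_all add: u_def mult.commute subdegree_f)
  have "u * inverse u = 1" using inverse_mult_eq_1'[OF u(2)] .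
  moreover have "f * (fps_X ^ 40 * (w * inverse u)) = fps_X ^ 20 * fps_X ^ 40 * w * (u * inverse u)"
    unfolding u(1) by (simp only: mult_ac)
  ultimately have "f * (fps_X ^ 40 * (w * inverse u)) = fps_X ^ 60 * w" by (simp flip: power_add)
  hence "g * g = f * (\<alpha> * f + \<beta> * g + fps_X ^ 40 * (w * inverse u))"
    using w by (simp only: distrib_left diff_eq_eq ac_simps)
  moreover have "\<alpha> * f + \<beta> * g + fps_X ^ 40 * (w * inverse u) \<in> I"
    using carr by (intro I_add I_memI conductor_subset) auto
  ultimately show ?thesis by blast
qed

lemma I_mult_I: "x \<in> I \<Longrightarrow> y \<in> I \<Longrightarrow> \<exists>j\<in>I. x * y = f * j"
proof -
  assume "x \<in> I" "y \<in> I"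
  then obtain p q p' q' where pq: "p \<in> carrier A511" "q \<in> carrier A511" "x = p * f + q * g"
    "p' \<in> carrier A511" "q' \<in> carrier A511" "y = p' * f + q' * g" by (auto simp: I_def)
  obtain j where j: "j \<in> I" "g * g = f * j" using square_in by blast
  have "x * y = f * (p * p' * f + (p * q' + q * p') * g) + q * q' * (g * g)"
    using pq by (simp add: algebra_simps)
  also have "\<dots> = f * (p * p' * f + (p * q' + q * p') * g + q * q' * j)"
    unfolding j(2) by (simp add: algebra_simps)
  finally show ?thesis using pq j
    by (intro bexI[of _ "p * p' * f + (p * q' + q * p') * g + q * q' * j"]) (auto intro!: I_add I_memI I_mult)
qed

text \<open>
  The duality behind the theorem: 39 is the largest gap of the semigroup, so \<open>f A\<close> has no element
  of order 59. If \<open>n\<close> is not in \<open>20 + \<langle>5,6\<rangle>\<close> then \<open>59 - n\<close> is, and a multiplier of order \<open>n\<close>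
  would carry an element of \<open>I\<close> of order \<open>59 - n\<close> to order 59.
\<close>

lemma multiplier_order:
  assumes q: "q \<in> carrier A511" "q \<noteq> 0" and mult: "\<And>i. i \<in> I \<Longrightarrow> \<exists>a\<in>carrier A511. q * i = f * a"
  shows "20 + 6 * (subdegree q mod 5) \<le> subdegree q"
proof (rule ccontr)
  define n where "n = subdegree q"
  assume "\<not> ?thesis"
  hence n: "n < 20 + 6 * (n mod 5)" by (simp add: n_def)
  define k r where "k = n div 5" and "r = n mod 5"
  have nkr: "n = 5 * k + r" and r: "r < 5" by (simp_all add: k_def r_def)
  have k: "k \<le> 3 + r" using n nkr by (simp add: r_def[symmetric])
  hence "n \<le> 59" using nkr r by linarith
  have "59 - n = (4 - r) + 5 * (11 - k)" using nkr r k by linarith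
  hence "(59 - n) mod 5 = 4 - r" by simp
  hence S: "20 + 6 * ((59 - n) mod 5) \<le> 59 - n" using nkr k r by linarith
  obtain i where i: "i \<in> I" "i \<noteq> 0" "subdegree i = 59 - n" using ex_order[OF S] by blast
  moreover obtain a where a: "a \<in> carrier A511" "q * i = f * a" using mult[OF i(1)] by blast
  ultimately have "subdegree (f * a) = 59" "f * a \<noteq> 0"
    using q \<open>n \<le> 59\<close> by (auto simp: n_def simp flip: a(2))
  hence "subdegree a = 39" using subdegree_f by auto
  thus False using A511_subdegree[OF a(1)] by simp
qed

lemma subdegree_I: "x \<in> I \<Longrightarrow> x \<noteq> 0 \<Longrightarrow> 20 + 6 * (subdegree x mod 5) \<le> subdegree x"
  using I_mult_I I_carrier by (intro multiplier_order) blast+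

text \<open>
  This is the equality \<open>fA : g = I\<close>: after subtracting an element of \<open>I\<close>, the multiplier \<open>q\<close> has no
  coefficient at an exponent that the previous bound allows as its order.
\<close>

lemma colon:
  assumes q: "q \<in> carrier A511" "a \<in> carrier A511" "q * g = f * a" shows "q \<in> I"
proof -
  obtain i where i: "i \<in> I" "\<forall>n. 20 + 6 * (n mod 5) \<le> n \<longrightarrow> i $ n = q $ n"
    using ex_prescribed[of 0 "\<lambda>n. q $ n"] by auto
  have "q - i = 0"
  proof (rule ccontr)
    assume nz: "q - i \<noteq> 0"
    have "20 + 6 * (subdegree (q - i) mod 5) \<le> subdegree (q - i)"
    proof (rule multiplier_order[OF _ nz])
      show "q - i \<in> carrier A511" using q i I_carrier by blast
      fix x assume x: "x \<in> I"
      then obtain r s where rs: "r \<in> carrier A511" "s \<in> carrier A511" "x = r * f + s * g"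
        by (auto simp: I_def)
      obtain j where j: "j \<in> I" "i * x = f * j" using I_mult_I[OF i(1) x] by blast
      have "(q - i) * x = f * (q * r) + s * (q * g) - i * x" using rs by (simp add: algebra_simps)
      also have "\<dots> = f * (q * r + s * a - j)" unfolding q(3) j(2) by (simp add: algebra_simps)
      finally show "\<exists>b\<in>carrier A511. (q - i) * x = f * b"
        using q rs I_carrier[OF j(1)] by blast
    qed
    hence "(q - i) $ subdegree (q - i) = 0" using i(2) by simp
    thus False using nth_subdegree_nonzero[OF nz] by contradiction
  qed
  thus ?thesis using i by simp
qed

lemma I_square_eq: "ideal_prod A511 I I = (\<lambda>h. f * h) ` I"
proof (intro equalityI subsetI)
  fix x assume "x \<in> ideal_prod A511 I I"
  thus "x \<in> (\<lambda>h. f * h) ` I"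
  proof (induction x rule: ideal_prod.induct)
    case (prod i j)
    thus ?case using I_mult_I by auto
  next
    case (sum s1 s2)
    thus ?case using I_add by (auto simp flip: distrib_left)
  qed
next
  fix x assume "x \<in> (\<lambda>h. f * h) ` I"
  thus "x \<in> ideal_prod A511 I I" using ideal_prod.prod[OF f_in_I, of _ I A511] by auto
qed

lemma principal_mult_eq: "ideal_prod A511 (genideal A511 {f}) I = (\<lambda>h. f * h) ` I"
proof (intro equalityI subsetI)
  fix x assume "x \<in> ideal_prod A511 (genideal A511 {f}) I"
  thus "x \<in> (\<lambda>h. f * h) ` I"
  proof (induction x rule: ideal_prod.induct)
    case (prod i j)
    then obtain p where p: "p \<in> carrier A511" "i = p * f" using genideal_A511_single[OF carr(1)] by blast
    have "i * j = f * (p * j)" using p by (simp add: mult_ac)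
    moreover have "p * j \<in> I" using p prod I_mult by blast
    ultimately show ?case by auto
  next
    case (sum s1 s2)
    thus ?case using I_add by (auto simp flip: distrib_left)
  qed
next
  fix x assume "x \<in> (\<lambda>h. f * h) ` I"
  moreover have "f \<in> genideal A511 {f}" using A511.genideal_self[of "{f}"] carr by auto
  ultimately show "x \<in> ideal_prod A511 (genideal A511 {f}) I"
    using ideal_prod.prod[of f _ _ I A511] by auto
qed

lemma one_notin_I: "1 \<notin> I"
  using subdegree_I[of 1] by auto

text \<open>
  From \<open>p f + q g \<in> I\<^sup>2 = f I\<close> one gets \<open>q g \<in> f A\<close>, hence \<open>q \<in> I\<close>; then \<open>q g \<in> f I\<close> and \<open>p \<in> I\<close>.
\<close>

lemma free_conormal: "free_module (A511 Quot I) (conormal_module A511 I)"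
proof (rule A511.free_conormal_moduleI[OF ideal_I _ f_in_I g_in_I])
  show "I \<noteq> carrier A511" using one_notin_I by blast
  show "\<exists>p\<in>carrier A511. \<exists>q\<in>carrier A511. x = p \<otimes>\<^bsub>A511\<^esub> f \<oplus>\<^bsub>A511\<^esub> q \<otimes>\<^bsub>A511\<^esub> g" if "x \<in> I" for x
    using that by (auto simp: I_def)
  fix p q assume pq: "p \<in> carrier A511" "q \<in> carrier A511"
    "p \<otimes>\<^bsub>A511\<^esub> f \<oplus>\<^bsub>A511\<^esub> q \<otimes>\<^bsub>A511\<^esub> g \<in> ideal_prod A511 I I"
  then obtain j where j: "j \<in> I" "p * f + q * g = f * j" by (auto simp: I_square_eq)
  have "q * g = f * (j - p)" using j(2) by (simp add: algebra_simps)
  hence q: "q \<in> I" using colon pq j I_carrier A511_diff by blast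
  obtain j' where j': "j' \<in> I" "q * g = f * j'" using I_mult_I[OF q g_in_I] by blast
  have "f * p = f * (j - j')" using j(2) j'(2) by (simp add: algebra_simps)
  hence "p = j - j'" using nonzero by simp
  thus "p \<in> I \<and> q \<in> I" using q I_diff j j' by blast
qed

lemma Ulrich: "Ulrich_ideal A511 I"
proof -
  let ?Q = "genideal A511 {f}"
  interpret Q: ideal ?Q A511 using carr by (intro A511.genideal_ideal) auto
  have Q_sub: "?Q \<subseteq> I" unfolding genideal_A511_single[OF carr(1)] using I_mult[OF f_in_I] by blast
  have g_notin: "g \<notin> ?Q"
  proof
    assume "g \<in> ?Q"
    then obtain p where p: "p \<in> carrier A511" "g = p * f" using genideal_A511_single[OF carr(1)] by blast
    hence "p \<noteq> 0" using nonzero by auto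
    hence "subdegree p = 6" using p subdegree_f subdegree_g nonzero by auto
    thus False using A511_subdegree[OF p(1)] by simp
  qed
  \<comment> \<open>\<open>f t\<^sup>4\<^sup>0 V = t\<^sup>6\<^sup>0 V\<close>, and \<open>t\<^sup>4\<^sup>0 V \<subseteq> A\<close>.\<close>
  have Qbig: "x \<in> ?Q" if x: "fps_X ^ 60 dvd x" for x
  proof -
    have "f dvd x"
      using x nonzero subdegree_f by (cases "x = 0") (auto simp: fps_X_power_dvd_iff_subdegree fps_dvd_iff)
    then obtain v where v: "x = f * v" by blast
    have "fps_X ^ 40 dvd v"
      using x nonzero subdegree_f unfolding v
      by (cases "v = 0") (auto simp: fps_X_power_dvd_iff_subdegree)
    hence "v \<in> carrier A511" by (rule A511_conductor)
    thus ?thesis unfolding genideal_A511_single[OF carr(1)] v by (auto simp: mult.commute[of f])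
  qed
  have red: "reduction_of A511 ?Q I"
  proof -
    have "I [^]\<^bsub>ideals_set A511\<^esub> (1::nat) = I"
      using A511.ideal_prod_one[OF ideal_I] A511.ideal_prod_commute[OF ideal_I A511.oneideal]
      by (simp add: ideals_set_def nat_pow_def)
    moreover have "I [^]\<^bsub>ideals_set A511\<^esub> Suc 1 = ideal_prod A511 (I [^]\<^bsub>ideals_set A511\<^esub> (1::nat)) I"
      by (simp add: ideals_set_def nat_pow_def)
    ultimately show ?thesis using Q_sub I_square_eq principal_mult_eq
      unfolding reduction_of_def by (intro conjI exI[of _ 1]) auto
  qed
  have "local_ring A511" by (rule local_ring_semigroup_ring) (fact semigroup_5_11_closed)+
  moreover have "primary_to A511 (max_ideal A511) I"
    by (rule primary_to_max_ideal_A511[OF ideal_I one_notin_I conductor_subset])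
  moreover have "primary_to A511 (max_ideal A511) ?Q"
    using one_notin_I Q_sub Qbig by (intro primary_to_max_ideal_A511[OF Q.is_ideal, of 60]) auto
  ultimately show ?thesis unfolding Ulrich_ideal_def Let_def
    using red free_conormal g_notin g_in_I carr I_square_eq principal_mult_eq by blast
qed

end

section \<open>Length and data\<close>

text \<open>
  The semigroup has exactly ten elements outside \<open>20 + \<langle>5,6\<rangle>\<close>; their number is the length of
  \<open>A/I\<close>.
\<close>

lemma order_gaps:
  fixes n :: nat
  assumes "11 * (n mod 5) \<le> n" "n < 20 + 6 * (n mod 5)"
  shows "n \<in> {0, 5, 10, 11, 15, 16, 21, 22, 27, 33}"
proof -
  define k r where "k = n div 5" and "r = n mod 5"
  have n: "n = 5 * k + r" and r: "r < 5" by (simp_all add: k_def r_def)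
  have "11 * r \<le> n" "n < 20 + 6 * r" using assms by (simp_all only: r_def)
  hence k: "2 * r \<le> k" "k < 4 + r" using n by linarith+
  from r have "r = 0 \<or> r = 1 \<or> r = 2 \<or> r = 3 \<or> r = 4" by linarith
  moreover from k r have "k = 0 \<or> k = 1 \<or> k = 2 \<or> k = 3 \<or> k = 4 \<or> k = 5 \<or> k = 6" by linarith
  ultimately show ?thesis using k unfolding n by (elim disjE) simp_all
qed

lemma ideal_A511_X_power:
  "ideal {x \<in> carrier A511. fps_X ^ m dvd x} (A511 :: 'k::field fps ring)"
proof (rule idealI)
  show "ring (A511 :: 'k fps ring)" by (rule A511.ring_axioms)
  show "subgroup {x \<in> carrier A511. fps_X ^ m dvd x} (add_monoid (A511 :: 'k fps ring))"
    by (rule A511.add.subgroupI) auto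
qed auto

context ulrich_pair
begin

text \<open>
  Along a strict chain of ideals containing \<open>I\<close>, the set of orders outside \<open>20 + \<langle>5,6\<rangle>\<close> grows at
  each step.
\<close>

lemma length_le:
  fixes N :: "nat \<Rightarrow> 'k fps set set"
  assumes sub: "\<And>i. i \<le> n \<Longrightarrow> submodule (N i) A511 (cyclic_module A511 I)"
    and strict: "\<And>i. i < n \<Longrightarrow> N i \<subset> N (Suc i)"
  shows "n \<le> 10"
proof -
  define J where "J i = {x \<in> carrier A511. I +>\<^bsub>A511\<^esub> x \<in> N i}" for i
  have J: "ideal (J i) A511" "I \<subseteq> J i" "N i = (\<lambda>x. I +>\<^bsub>A511\<^esub> x) ` J i" if "i \<le> n" for i
    using A511.submodule_cyclic_vimage[OF ideal_I sub[OF that]] unfolding J_def by blast+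
  define T :: "nat set" where "T = {0, 5, 10, 11, 15, 16, 21, 22, 27, 33}"
  define vals where "vals i = {subdegree x | x. x \<in> J i \<and> x \<noteq> 0 \<and> subdegree x \<in> T}" for i
  have vals_T: "vals i \<subseteq> T" for i by (auto simp: vals_def)
  have fin: "finite (vals i)" for i using vals_T by (rule finite_subset) (simp add: T_def)
  have vals_strict: "vals i \<subset> vals (Suc i)" if "i < n" for i
  proof
    have i: "i \<le> n" "Suc i \<le> n" using that by auto
    have sub': "J i \<subseteq> J (Suc i)" using strict[OF that] by (auto simp: J_def)
    thus "vals i \<subseteq> vals (Suc i)" unfolding vals_def by blast
    show "vals i \<noteq> vals (Suc i)"
    proof
      assume eq: "vals i = vals (Suc i)"
      have "J i = J (Suc i)"
      proof (rule ideal_eqI_subdegree[OF J(1)[OF i(1)] J(1)[OF i(2)] sub'])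
        show "x \<in> J i" if "fps_X ^ 40 dvd x" for x
          using conductor_subset[OF that] J(2)[OF i(1)] by blast
        fix x assume x: "x \<in> J (Suc i)" "x \<noteq> 0"
        show "\<exists>y\<in>J i. y \<noteq> 0 \<and> subdegree y = subdegree x"
        proof (cases "20 + 6 * (subdegree x mod 5) \<le> subdegree x")
          case True
          thus ?thesis using ex_order J(2)[OF i(1)] by blast
        next
          case False
          have "x \<in> carrier A511" using x by (simp add: J_def)
          hence "subdegree x \<in> T" unfolding T_def using False by (intro order_gaps A511_subdegree) simp_all
          hence "subdegree x \<in> vals (Suc i)" 
            unfolding vals_def by (intro CollectI exI[of _ x] conjI refl x)
          hence "subdegree x \<in> vals i" unfolding eq .
          then obtain y where "subdegree x = subdegree y" "y \<in> J i" "y \<noteq> 0"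
            unfolding vals_def by (elim CollectE exE conjE)
          thus ?thesis by (intro bexI[of _ y] conjI) simp_all
        qed
      qed
      hence "N i = N (Suc i)" using J(3) i by metis
      thus False using strict[OF that] by blast
    qed
  qed
  have "i \<le> card (vals i)" if "i \<le> n" for i using that
  proof (induction i)
    case (Suc i)
    hence "card (vals i) < card (vals (Suc i))" using vals_strict fin by (intro psubset_card_mono) auto
    thus ?case using Suc by simp
  qed simp
  hence "n \<le> card (vals n)" by simp
  also have "\<dots> \<le> card T" using vals_T by (intro card_mono) (auto simp: T_def)
  finally show ?thesis by (simp add: T_def)
qed

text \<open>
  The images of \<open>A \<inter> t\<^sup>m V\<close>, for \<open>m\<close> running down from 40 through the ten exponents, form a strict
  chain: \<open>t\<^sup>m\<close> is not congruent modulo \<open>I\<close> to an element of higher order.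
\<close>

lemma length_ge:
  "\<exists>N. (\<forall>i\<le>10. submodule (N i) A511 (cyclic_module A511 I)) \<and> (\<forall>i<10::nat. N i \<subset> N (Suc i))"
proof -
  define ms :: "nat list" where "ms = [40, 33, 27, 22, 21, 16, 15, 11, 10, 5, 0]"
  define L :: "nat \<Rightarrow> 'k fps set" where "L m = {x \<in> carrier A511. fps_X ^ m dvd x}" for m
  define N where "N i = (\<lambda>x. I +>\<^bsub>A511\<^esub> x) ` L (ms ! i)" for i
  have "N i \<subset> N (Suc i)" if "i < 10" for i
  proof -
    define m m' where "m = ms ! Suc i" and "m' = ms ! i"
    have "i \<in> {0, 1, 2, 3, 4, 5, 6, 7, 8, 9}" using that by auto
    hence m: "m < m'" "11 * (m mod 5) \<le> m" "\<not> 20 + 6 * (m mod 5) \<le> m"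
      by (auto simp: ms_def m_def m'_def)
    have "L m' \<subseteq> L m" using m(1) by (auto simp: L_def intro: power_le_dvd)
    hence "N i \<subseteq> N (Suc i)" by (auto simp: N_def m_def m'_def)
    moreover have "I +>\<^bsub>A511\<^esub> fps_X ^ m \<in> N (Suc i)"
      using m(2) by (auto simp: N_def m_def L_def)
    moreover have "I +>\<^bsub>A511\<^esub> fps_X ^ m \<notin> N i"
    proof
      assume "I +>\<^bsub>A511\<^esub> fps_X ^ m \<in> N i"
      then obtain x where x: "x \<in> carrier A511" "fps_X ^ m' dvd x"
        "I +>\<^bsub>A511\<^esub> fps_X ^ m = I +>\<^bsub>A511\<^esub> x" by (auto simp: N_def m'_def L_def)
      hence "fps_X ^ m - x \<in> I"
        using m(2) ideal.rcos_eq_iff[OF ideal_I, of "fps_X ^ m" x] by simp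
      moreover have c: "(fps_X ^ m - x) $ j = (if j = m then 1 else 0)" if "j \<le> m" for j
        using x(2) that m(1) by (auto simp: fps_X_power_dvd_iff)
      moreover have "subdegree (fps_X ^ m - x) = m" by (rule subdegreeI) (use c in auto)
      moreover have "fps_X ^ m - x \<noteq> 0" using c[of m] by (metis fps_zero_nth order_refl zero_neq_one)
      ultimately show False using subdegree_I m(3) by metis
    qed
    ultimately show ?thesis by blast
  qed
  moreover have "submodule (N i) A511 (cyclic_module A511 I)" for i
    unfolding N_def L_def by (intro A511.submodule_cyclic_image ideal_I ideal_A511_X_power)
  ultimately show ?thesis by blast
qed

lemma length_quotient: "module_length A511 (cyclic_module A511 I) = 10"
proof -
  have "module_length A511 (cyclic_module A511 I) \<le> enat 10"
    unfolding module_length_def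
  proof (rule Sup_least, clarify)
    fix n and N :: "nat \<Rightarrow> 'k fps set set"
    assume "\<forall>i\<le>n. submodule (N i) A511 (cyclic_module A511 I)" "\<forall>i<n. N i \<subset> N (Suc i)"
    thus "enat n \<le> enat 10" using length_le[of n N] by simp
  qed
  moreover have "enat 10 \<le> module_length A511 (cyclic_module A511 I)"
    unfolding module_length_def using length_ge by (intro Sup_upper) blast
  ultimately show ?thesis by (simp add: numeral_eq_enat)
qed

lemma possesses_data: "possesses_data semigroup_5_11 I 20 26"
proof -
  have "enat 20 = 2 * module_length A511 (cyclic_module A511 I)"
    by (simp add: length_quotient numeral_eq_enat[symmetric])
  moreover have "range (\<lambda>v. fps_X ^ 34 * v) \<inter> carrier A511 \<subseteq> I" using order_34_subset by auto
  moreover have "conductor_ideal semigroup_5_11 \<subseteq> I"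
    unfolding conductor_ideal_5_11 using conductor_subset by auto
  ultimately show ?thesis
    unfolding possesses_data_def Let_def conductor_5_11
    using f_in_I g_in_I nonzero subdegree_f subdegree_g I_eq I_square_eq
    by (intro bexI[of _ f] bexI[of _ g]) (simp_all add: mem_semigroup_5_11)
qed

lemma I_in: "I \<in> Ulrich_ideals_with_data semigroup_5_11 20 26"
  using Ulrich possesses_data by (simp add: Ulrich_ideals_with_data_def)

section \<open>Change of generators\<close>

text \<open>
  Two elements of \<open>I\<close> of the orders of \<open>f\<close> and \<open>g\<close> generate \<open>I\<close>, because the matrix that expresses
  them is triangular modulo the maximal ideal, with units on the diagonal.
\<close>

lemma generators:
  assumes f': "f' \<in> I" "subdegree f' = 20" and g': "g' \<in> I" "subdegree g' = 26"
  shows "I = genideal A511 {f', g'}"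
proof -
  obtain p q where pq: "p \<in> carrier A511" "q \<in> carrier A511" "f' = p * f + q * g"
    using f' by (auto simp: I_def)
  obtain r s where rs: "r \<in> carrier A511" "s \<in> carrier A511" "g' = r * f + s * g"
    using g' by (auto simp: I_def)
  have fn: "f $ 20 \<noteq> 0" using nth_subdegree_nonzero[OF nonzero(1)] subdegree_f by simp
  have xf20: "(x * f) $ 20 = x $ 0 * f $ 20" for x
    by (simp add: fps_mult_nth_conv_upto_subdegree_right subdegree_f)
  have xg20: "(x * g) $ 20 = 0" for x
    by (rule fps_mult_nth_outside_subdegrees) (simp add: subdegree_g)
  have f'20: "f' $ 20 \<noteq> 0" using f'(2) nth_subdegree_nonzero[of f'] by (cases "f' = 0") auto
  hence p0: "p $ 0 \<noteq> 0" by (auto simp: pq(3) xf20 xg20)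
  have g'm: "g' $ m = 0" if "m < 26" for m using that g'(2) by (simp only: nth_less_subdegree_zero)
  from g'm[of 20] have r0: "r $ 0 = 0" using fn by (simp add: rs(3) xf20 xg20)
  \<comment> \<open>If \<open>s\<close> were a nonunit, \<open>r f\<close> would have order 26, and \<open>r\<close> the gap 6.\<close>
  have s0: "s $ 0 \<noteq> 0"
  proof
    assume "s $ 0 = 0"
    hence "fps_X ^ 5 dvd s" using A511_dvd_X5 rs by blast
    moreover have "fps_X ^ 26 dvd g" by (simp add: fps_X_power_dvd_iff_subdegree subdegree_g)
    ultimately have "fps_X ^ 5 * fps_X ^ 26 dvd s * g" by (rule mult_dvd_mono)
    hence sg: "(s * g) $ m = 0" if "m < 31" for m
      using that by (simp add: fps_X_power_dvd_iff flip: power_add)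
    have rf: "r * f = g' - s * g" using rs(3) by simp
    have "g' $ 26 \<noteq> 0" using g'(2) nth_subdegree_nonzero[of g'] by (cases "g' = 0") auto
    hence "subdegree (r * f) = 26" unfolding rf by (intro subdegreeI) (simp_all add: sg g'm)
    moreover from this have "r * f \<noteq> 0" by auto
    ultimately have "subdegree r = 6" using subdegree_f by auto
    thus False using A511_subdegree[OF rs(1)] by simp
  qed
  define d where "d = p * s - q * r"
  have d: "d \<in> carrier A511" "d $ 0 \<noteq> 0" using pq rs p0 r0 s0 by (auto simp: d_def)
  have inv: "inverse d * d = 1" using inverse_mult_eq_1[OF d(2)] .
  let ?J = "genideal A511 {f', g'}"
  have carr': "f' \<in> carrier A511" "g' \<in> carrier A511" using f' g' I_carrier by blast+
  have J: "ideal ?J A511" using carr' by (intro A511.genideal_ideal) auto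
  have J': "?J \<subseteq> I" using f' g' by (intro A511.genideal_minimal ideal_I) auto
  have gens: "f' \<in> ?J" "g' \<in> ?J" using A511.genideal_self[of "{f', g'}"] carr' by auto
  have df: "d * f = s * f' - q * g'" and dg: "d * g = p * g' - r * f'"
    unfolding pq(3) rs(3) d_def by (simp_all add: algebra_simps)
  have "d * f \<in> ?J" "d * g \<in> ?J"
    unfolding df dg by (intro ideal_A511_diff[OF J] ideal_A511_mult[OF J] gens pq rs)+
  hence "inverse d * (d * f) \<in> ?J" "inverse d * (d * g) \<in> ?J"
    using ideal_A511_mult[OF J] A511_inverse[OF d] by blast+
  hence "f \<in> ?J" "g \<in> ?J" using inv by (simp_all only: mult.assoc[symmetric] mult_1_left)
  hence "I \<subseteq> ?J" unfolding I_eq by (intro A511.genideal_minimal J) auto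
  with J' show ?thesis by blast
qed

lemma subdegree_f_mult_I:
  assumes "j \<in> I" "f * j \<noteq> 0"
  shows "40 + 6 * (subdegree (f * j) mod 5) \<le> subdegree (f * j)"
proof -
  have "j \<noteq> 0" using assms by auto
  hence s: "subdegree (f * j) = 20 + subdegree j" using subdegree_f nonzero by simp
  have "(20 + subdegree j) mod 5 = subdegree j mod 5"
  proof -
    have "20 + subdegree j = subdegree j + 5 * 4" by simp
    thus ?thesis by (simp only: mod_mult_self2)
  qed
  thus ?thesis using subdegree_I[OF assms(1) \<open>j \<noteq> 0\<close>] unfolding s by linarith
qed

text \<open>
  The exponents 53, 54 and 59 are not in \<open>40 + \<langle>5,6\<rangle>\<close>, so they are not orders in \<open>I\<^sup>2\<close>.
\<close>

lemma I_square_gap: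
  assumes "x \<in> I" "y \<in> I" "z \<in> I" "w \<in> I"
    and eq: "x * y - z * w = fps_X ^ 51 * W" and W: "\<And>m. m < n \<Longrightarrow> W $ m = 0"
    and n: "n \<in> {2, 3, 8}"
  shows "W $ n = 0"
proof (rule ccontr)
  assume nz: "W $ n \<noteq> 0"
  obtain j where j: "j \<in> I" "x * y = f * j" using I_mult_I[OF assms(1,2)] by blast
  obtain j' where j': "j' \<in> I" "z * w = f * j'" using I_mult_I[OF assms(3,4)] by blast
  have eq': "f * (j - j') = fps_X ^ 51 * W" using eq j j' by (simp add: right_diff_distrib)
  have "W \<noteq> 0" "subdegree W = n" using nz W by (auto intro: subdegreeI)
  hence "subdegree (f * (j - j')) = 51 + n" "f * (j - j') \<noteq> 0" unfolding eq' by auto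
  thus False using subdegree_f_mult_I[of "j - j'"] I_diff[OF j(1) j'(1)] n by auto
qed

end

section \<open>The equations between the coefficients\<close>

text \<open>
  The unit factors of the generators in normal form. Splitting off \<open>t\<^sup>2\<^sup>0\<close> and \<open>t\<^sup>2\<^sup>6\<close> reduces the relation
  between \<open>f\<close> and \<open>g\<close> modulo \<open>t\<^sup>6\<^sup>0\<close> to nine coefficients.
\<close>

definition unit_f :: "'k::field \<Rightarrow> 'k \<Rightarrow> 'k \<Rightarrow> 'k \<Rightarrow> 'k fps" where
  "unit_f a1 a2 a3 a4 =
     1 + fps_const a1 * fps_X + fps_const a2 * fps_X ^ 2 + fps_const a3 * fps_X ^ 7 + fps_const a4 * fps_X ^ 13"

definition unit_g :: "'k::field \<Rightarrow> 'k \<Rightarrow> 'k fps" where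
  "unit_g b1 b2 = 1 + fps_const b1 * fps_X + fps_const b2 * fps_X ^ 7"

lemma unit_f_mult_nth:
  "(unit_f a1 a2 a3 a4 * h) $ n =
     h $ n + (if n < 1 then 0 else a1 * h $ (n - 1)) + (if n < 2 then 0 else a2 * h $ (n - 2))
       + (if n < 7 then 0 else a3 * h $ (n - 7)) + (if n < 13 then 0 else a4 * h $ (n - 13))"
  using fps_X_power_mult_nth[of 1 h n]
  by (simp add: unit_f_def distrib_right mult.assoc fps_X_power_mult_nth)

lemma unit_g_mult_nth:
  "(unit_g b1 b2 * h) $ n =
     h $ n + (if n < 1 then 0 else b1 * h $ (n - 1)) + (if n < 7 then 0 else b2 * h $ (n - 7))"
  using fps_X_power_mult_nth[of 1 h n]
  by (simp add: unit_g_def distrib_right mult.assoc fps_X_power_mult_nth)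

lemma unit_f_nth: "unit_f a1 a2 a3 a4 $ n = (if n = 0 then 1 else 0) + (if n = 1 then a1 else 0)
    + (if n = 2 then a2 else 0) + (if n = 7 then a3 else 0) + (if n = 13 then a4 else 0)"
  by (simp add: unit_f_def fps_X_nth)

lemma unit_g_nth: "unit_g b1 b2 $ n =
    (if n = 0 then 1 else 0) + (if n = 1 then b1 else 0) + (if n = 7 then b2 else 0)"
  by (simp add: unit_g_def fps_X_nth)

text \<open>
  For \<open>f = t\<^sup>2\<^sup>0 F\<close> and \<open>g = t\<^sup>2\<^sup>6 G\<close>, the defect is \<open>(g\<^sup>2 - f (\<alpha> f + \<beta> g)) / t\<^sup>5\<^sup>1\<close>, with \<open>\<alpha>\<close> and \<open>\<beta>\<close>
  defined next. Modulo \<open>t\<^sup>6\<^sup>0\<close>, only the terms of \<open>\<alpha>\<close> up to exponent 19 and those of \<open>\<beta>\<close> up to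
  exponent 13 matter; the lowest ones are absent because \<open>g\<^sup>2\<close> has order 52, and the coefficients
  of \<open>t\<^sup>1\<^sup>1\<close> in \<open>\<alpha>\<close> and of \<open>t\<^sup>5\<close> in \<open>\<beta>\<close> are opposite because they must cancel at exponent 51.
\<close>

definition defect :: "'k::field fps \<Rightarrow> 'k fps \<Rightarrow> 'k \<Rightarrow> 'k \<Rightarrow> 'k \<Rightarrow> 'k \<Rightarrow> 'k \<Rightarrow> 'k fps" where
  "defect F G s c15 c16 d10 d11 = fps_X ^ 1 * (G * G) - fps_const s * (F * (G - F))
     - fps_const c15 * (fps_X ^ 4 * (F * F)) - fps_const d10 * (fps_X ^ 5 * (F * G))
     - fps_const c16 * (fps_X ^ 5 * (F * F)) - fps_const d11 * (fps_X ^ 6 * (F * G))"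

definition coeff_\<alpha> :: "'k::field \<Rightarrow> 'k \<Rightarrow> 'k \<Rightarrow> 'k fps" where
  "coeff_\<alpha> s c15 c16 = fps_const c15 * fps_X ^ 15 + fps_const c16 * fps_X ^ 16 - fps_const s * fps_X ^ 11"

definition coeff_\<beta> :: "'k::field \<Rightarrow> 'k \<Rightarrow> 'k \<Rightarrow> 'k fps" where
  "coeff_\<beta> s d10 d11 = fps_const s * fps_X ^ 5 + fps_const d10 * fps_X ^ 10 + fps_const d11 * fps_X ^ 11"

lemma coeff_carrier: "coeff_\<alpha> s c15 c16 \<in> carrier A511" "coeff_\<beta> s d10 d11 \<in> carrier A511"
  unfolding coeff_\<alpha>_def coeff_\<beta>_def by (intro A511_add A511_diff A511_mult A511_const A511_X_power; simp)+

lemma fps_X_power_shift: "fps_X ^ m * (fps_X ^ n * h) = (fps_X ^ (m + n) * h :: 'k::field fps)"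
  by (simp add: power_add mult.assoc)

lemma defect_eq:
  fixes F G :: "'k::field fps"
  shows "fps_X ^ 26 * G * (fps_X ^ 26 * G) - fps_X ^ 20 * F *
      (coeff_\<alpha> s c15 c16 * (fps_X ^ 20 * F) + coeff_\<beta> s d10 d11 * (fps_X ^ 26 * G))
    = fps_X ^ 51 * defect F G s c15 c16 d10 d11"
proof -
  have "fps_X * fps_X ^ 51 = (fps_X ^ 52 :: 'k fps)" by (simp flip: power_Suc)
  thus ?thesis unfolding coeff_\<alpha>_def coeff_\<beta>_def defect_def
    by (simp add: algebra_simps fps_X_power_shift flip: power_add)
qed

lemma defect_nth:
  fixes a1 a2 a3 a4 b1 b2 s c15 c16 d10 d11 :: "'k::field"
  defines "F \<equiv> unit_f a1 a2 a3 a4" and "G \<equiv> unit_g b1 b2"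
  defines "W \<equiv> defect F G s c15 c16 d10 d11"
  shows "W $ 0 = 0" "W $ 1 = 1 - s * (b1 - a1)"
    "W $ 2 = 2 * b1 + s * (a2 - a1 * (b1 - a1))"
    "W $ 3 = b1\<^sup>2 + s * (a1 * a2 - a2 * (b1 - a1))"
    "W $ 4 = s * a2\<^sup>2 - c15"
    "W $ 5 = - 2 * a1 * c15 - d10 - c16"
    "W $ 6 = - (a1\<^sup>2 + 2 * a2) * c15 - (a1 + b1) * d10 - 2 * a1 * c16 - d11"
    "W $ 7 = s * (a3 - b2) - 2 * a1 * a2 * c15 - (a2 + a1 * b1) * d10 - (a1\<^sup>2 + 2 * a2) * c16
       - (a1 + b1) * d11"
    "W $ 8 = 2 * b2 + s * (a1 * (a3 - b2) - a3 * (b1 - a1)) - a2\<^sup>2 * c15 - a2 * b1 * d10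
       - 2 * a1 * a2 * c16 - (a2 + a1 * b1) * d11"
  unfolding W_def defect_def F_def G_def fps_sub_nth fps_mult_left_const_nth fps_X_power_mult_nth
    unit_f_mult_nth unit_g_mult_nth unit_f_nth unit_g_nth
  by (simp_all add: algebra_simps power2_eq_square)

text \<open>
  The five parameters are chosen so as to kill the coefficients at the exponents 52, 55, 56, 57 and
  58, which are orders in \<open>I\<^sup>2\<close>. Those at 53 and 54 vanish by the shape of the first coefficients of
  \<open>F\<close> and \<open>G\<close>. The coefficient at 59 remains, and gives the relation with \<open>55 \<epsilon>\<^sup>7\<close>.
\<close>

lemma defect_special:
  fixes \<epsilon> a3 a4 b2 y :: "'k::field"
  assumes "\<epsilon> \<noteq> 0"
    and y_def: "y = (a3 - b2) / \<epsilon> ^ 3 - 59 * \<epsilon> ^ 4"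
    and W_def: "W = defect (unit_f (3 * \<epsilon>) (\<epsilon>\<^sup>2) a3 a4) (unit_g (2 * \<epsilon>) b2)
      (- 1 / \<epsilon>) (- (\<epsilon> ^ 3)) y (6 * \<epsilon> ^ 4 - y) (- 19 * \<epsilon> ^ 5 - \<epsilon> * y)"
  shows "m < 8 \<Longrightarrow> W $ m = 0" and "W $ 8 = 2 * b2 - 55 * \<epsilon> ^ 7 - a3"
proof -
  define z where "z = (a3 - b2) / \<epsilon> ^ 3"
  have z: "a3 = b2 + z * \<epsilon> ^ 3" using assms(1) by (simp add: z_def)
  have y: "y = z - 59 * \<epsilon> ^ 4" by (simp add: y_def z_def)
  note nth = defect_nth[where ?a1.0 = "3 * \<epsilon>" and ?a2.0 = "\<epsilon>\<^sup>2" and ?a3.0 = a3 and ?a4.0 = a4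
      and ?b1.0 = "2 * \<epsilon>" and ?b2.0 = b2 and s = "- 1 / \<epsilon>" and ?c15.0 = "- (\<epsilon> ^ 3)"
      and ?c16.0 = y and ?d10.0 = "6 * \<epsilon> ^ 4 - y" and ?d11.0 = "- 19 * \<epsilon> ^ 5 - \<epsilon> * y",
      folded W_def]
  have "W $ 0 = 0" "W $ 1 = 0" "W $ 2 = 0" "W $ 3 = 0" "W $ 4 = 0" "W $ 5 = 0" "W $ 6 = 0"
    "W $ 7 = 0"
    unfolding nth y z using assms(1) by (simp_all add: field_simps power_numeral_reduce)
  moreover assume "m < 8"
  hence "m \<in> {0, 1, 2, 3, 4, 5, 6, 7}" by auto
  ultimately show "W $ m = 0" by auto
next
  define z where "z = (a3 - b2) / \<epsilon> ^ 3"
  have z: "a3 = b2 + z * \<epsilon> ^ 3" using assms(1) by (simp add: z_def)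
  have y: "y = z - 59 * \<epsilon> ^ 4" by (simp add: y_def z_def)
  show "W $ 8 = 2 * b2 - 55 * \<epsilon> ^ 7 - a3"
    unfolding W_def defect_nth y z using assms(1) by (simp add: field_simps power_numeral_reduce)
qed

section \<open>Normal forms\<close>

definition normal_f :: "'k::field \<Rightarrow> 'k \<Rightarrow> 'k \<Rightarrow> 'k \<Rightarrow> 'k fps" where
  "normal_f a1 a2 a3 a4 = fps_X ^ 20 + fps_const a1 * fps_X ^ 21 + fps_const a2 * fps_X ^ 22
     + fps_const a3 * fps_X ^ 27 + fps_const a4 * fps_X ^ 33"

definition normal_g :: "'k::field \<Rightarrow> 'k \<Rightarrow> 'k fps" where
  "normal_g b1 b2 = fps_X ^ 26 + fps_const b1 * fps_X ^ 27 + fps_const b2 * fps_X ^ 33"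

lemma param_ideal_eq:
  "param_ideal \<delta> \<epsilon> \<tau> = genideal A511 {normal_f (3 * \<epsilon>) (\<epsilon> ^ 2) (2 * \<tau> - 55 * \<epsilon> ^ 7) \<delta>, normal_g (2 * \<epsilon>) \<tau>}"
  by (simp add: param_ideal_def normal_f_def normal_g_def)

lemma normal_f_nth: "normal_f a1 a2 a3 a4 $ n = (if n = 20 then 1 else 0) + (if n = 21 then a1 else 0)
    + (if n = 22 then a2 else 0) + (if n = 27 then a3 else 0) + (if n = 33 then a4 else 0)"
  by (simp add: normal_f_def)

lemma normal_g_nth: "normal_g b1 b2 $ n =
    (if n = 26 then 1 else 0) + (if n = 27 then b1 else 0) + (if n = 33 then b2 else 0)"
  by (simp add: normal_g_def)

lemma normal_f_eq: "normal_f a1 a2 a3 a4 = fps_X ^ 20 * unit_f a1 a2 a3 a4"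
  by (rule fps_ext) (auto simp: normal_f_nth fps_X_power_mult_nth unit_f_nth)

lemma normal_g_eq: "normal_g b1 b2 = fps_X ^ 26 * unit_g b1 b2"
  by (rule fps_ext) (auto simp: normal_g_nth fps_X_power_mult_nth unit_g_nth)

lemma subdegree_normal: "subdegree (normal_f a1 a2 a3 a4) = 20" "subdegree (normal_g b1 b2) = 26"
  by (auto intro!: subdegreeI simp: normal_f_nth normal_g_nth)

lemma normal_carrier: "normal_f a1 a2 a3 a4 \<in> carrier A511" "normal_g b1 b2 \<in> carrier A511"
  unfolding normal_f_def normal_g_def
  by (intro A511_add A511_mult A511_const A511_X_power; simp)+

lemma ulrich_pair_normal:
  assumes "\<epsilon> \<noteq> 0"
  shows "\<exists>\<alpha> \<beta>. ulrich_pair (normal_f (3 * \<epsilon>) (\<epsilon> ^ 2) (2 * \<tau> - 55 * \<epsilon> ^ 7) \<delta>) (normal_g (2 * \<epsilon>) \<tau>) \<alpha> \<beta>"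
    (is "\<exists>\<alpha> \<beta>. ulrich_pair ?f ?g \<alpha> \<beta>")
proof -
  define a3 where "a3 = 2 * \<tau> - 55 * \<epsilon> ^ 7"
  define y where "y = (a3 - \<tau>) / \<epsilon> ^ 3 - 59 * \<epsilon> ^ 4"
  define W where "W = defect (unit_f (3 * \<epsilon>) (\<epsilon>\<^sup>2) a3 \<delta>) (unit_g (2 * \<epsilon>) \<tau>)
      (- 1 / \<epsilon>) (- (\<epsilon> ^ 3)) y (6 * \<epsilon> ^ 4 - y) (- 19 * \<epsilon> ^ 5 - \<epsilon> * y)"
  note W = defect_special[OF assms y_def W_def]
  have "W $ m = 0" if "m < 9" for m
    using that W(1)[of m] W(2) by (cases "m = 8") (auto simp: a3_def)
  hence "fps_X ^ 9 dvd W" by (simp add: fps_X_power_dvd_iff)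
  hence "fps_X ^ 51 * fps_X ^ 9 dvd fps_X ^ 51 * W" by (rule mult_dvd_mono[OF dvd_refl])
  hence "fps_X ^ 60 dvd fps_X ^ 51 * W" by (simp flip: power_add)
  hence "ulrich_pair ?f ?g (coeff_\<alpha> (- 1 / \<epsilon>) (- (\<epsilon> ^ 3)) y)
           (coeff_\<beta> (- 1 / \<epsilon>) (6 * \<epsilon> ^ 4 - y) (- 19 * \<epsilon> ^ 5 - \<epsilon> * y))"
    by (intro ulrich_pair.intro normal_carrier coeff_carrier subdegree_normal)
      (simp only: normal_f_eq normal_g_eq defect_eq W_def a3_def)
  thus ?thesis by blast
qed

context ulrich_pair
begin

text \<open>
  An element of \<open>I\<close> can be given the coefficient 1 at exponent 20 (or 26) and 0 at all larger
  exponents in \<open>20 + \<langle>5,6\<rangle>\<close>; the remaining exponents of the semigroup are those of the normal form.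
\<close>

lemma ex_normal_generators:
  "\<exists>a1 a2 a3 a4 b1 b2. normal_f a1 a2 a3 a4 \<in> I \<and> normal_g b1 b2 \<in> I"
proof -
  have supp: "n \<in> {20, 21, 22, 27, 33} \<and> (26 \<le> n \<longrightarrow> n \<in> {27, 33})"
    if "i \<in> I" "\<not> 20 + 6 * (n mod 5) \<le> n" "20 \<le> n" "i $ n \<noteq> 0" for i n
  proof -
    have "11 * (n mod 5) \<le> n" using that I_carrier by (auto simp: A511_iff)
    hence "n \<in> {0, 5, 10, 11, 15, 16, 21, 22, 27, 33}" using that(2) by (intro order_gaps) auto
    thus ?thesis using that(3) by auto
  qed
  obtain f' where f': "f' \<in> I" "\<forall>m<20. f' $ m = 0"
    "\<forall>n\<ge>20. 20 + 6 * (n mod 5) \<le> n \<longrightarrow> f' $ n = (if n = 20 then 1 else 0)"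
    using ex_prescribed[of 20 "\<lambda>n. if n = 20 then 1 else 0"] by blast
  have "f' = normal_f (f' $ 21) (f' $ 22) (f' $ 27) (f' $ 33)"
  proof (rule fps_ext)
    fix n
    have "f' $ 20 = 1" using f'(3) by simp
    moreover have "f' $ n = 0" if "n \<notin> {20, 21, 22, 27, 33}"
    proof (cases "n < 20 \<or> 20 + 6 * (n mod 5) \<le> n")
      case True
      thus ?thesis using that f'(2,3) by (metis insertCI not_less)
    next
      case False
      thus ?thesis using that supp[OF f'(1), of n] by auto
    qed
    ultimately show "f' $ n = normal_f (f' $ 21) (f' $ 22) (f' $ 27) (f' $ 33) $ n"
      by (auto simp: normal_f_nth)
  qed
  moreover obtain g' where g': "g' \<in> I" "\<forall>m<26. g' $ m = 0"
    "\<forall>n\<ge>26. 20 + 6 * (n mod 5) \<le> n \<longrightarrow> g' $ n = (if n = 26 then 1 else 0)"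
    using ex_prescribed[of 26 "\<lambda>n. if n = 26 then 1 else 0"] by blast
  have "g' = normal_g (g' $ 27) (g' $ 33)"
  proof (rule fps_ext)
    fix n
    have "g' $ 26 = 1" using g'(3) by simp
    moreover have "g' $ n = 0" if "n \<notin> {26, 27, 33}"
    proof (cases "n < 26 \<or> 20 + 6 * (n mod 5) \<le> n")
      case True
      thus ?thesis using that g'(2,3) by (metis insertCI not_less)
    next
      case False
      thus ?thesis using that supp[OF g'(1), of n] by auto
    qed
    ultimately show "g' $ n = normal_g (g' $ 27) (g' $ 33) $ n"
      by (auto simp: normal_g_nth)
  qed
  ultimately show ?thesis using f'(1) g'(1) by metis
qed

text \<open>
  An element \<open>p f + q g\<close> of order 32 exists in \<open>I\<close>. Its vanishing coefficients at 20, 25, 26, 30 and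
  31 leave only \<open>q\<^sub>5 (t\<^sup>5 g - t\<^sup>1\<^sup>1 f)\<close> to contribute at 32, namely \<open>q\<^sub>5 (b\<^sub>1 - a\<^sub>1)\<close>.
\<close>

lemma normal_generators_distinct:
  assumes fI: "normal_f a1 a2 a3 a4 \<in> I" and gI: "normal_g b1 b2 \<in> I"
  shows "a1 \<noteq> b1"
proof
  assume eq: "a1 = b1"
  obtain i where i: "i \<in> I" "i \<noteq> 0" "subdegree i = 32" using ex_order[of 32] by auto
  have gen: "I = genideal A511 {normal_f a1 a2 a3 a4, normal_g b1 b2}"
    using fI gI subdegree_normal by (intro generators)
  obtain p q where pq: "p \<in> carrier A511" "q \<in> carrier A511"
    "i = p * normal_f a1 a2 a3 a4 + q * normal_g b1 b2"
    using i(1) unfolding gen genideal_A511_pair[OF normal_carrier] by blast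
  have i_eq: "i = fps_X ^ 20 * (unit_f a1 a2 a3 a4 * p) + fps_X ^ 26 * (unit_g b1 b2 * q)"
    by (simp add: pq(3) normal_f_eq normal_g_eq mult_ac)
  have p: "p $ m = 0" and q: "q $ m = 0" if "m \<in> {1, 2, 3, 4, 6, 7, 8, 9, 12}" for m
    using that pq(1,2) by (auto intro!: A511_nth_eq_0)
  have i0: "i $ m = 0" if "m < 32" for m using that i(3) by (simp only: nth_less_subdegree_zero)
  note nth = i_eq fps_X_power_mult_nth unit_f_mult_nth unit_g_mult_nth
  have p0: "p $ 0 = 0" using i0[of 20] by (simp add: nth unit_f_nth)
  have p5: "p $ 5 = 0" using i0[of 25] by (simp add: nth p)
  have q0: "q $ 0 = 0" using i0[of 26] by (simp add: nth p p5 unit_g_nth)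
  have p10: "p $ 10 = 0" using i0[of 30] by (simp add: nth p q)
  have "p $ 11 + q $ 5 = 0" using i0[of 31] by (simp add: nth p q p10)
  hence "i $ 32 = 0" using eq by (simp add: nth p q p5 q0 p10 flip: distrib_left)
  thus False using nth_subdegree_nonzero[OF i(2)] i(3) by simp
qed

lemma normal_form_gap:
  fixes s c15 c16 d10 d11 :: 'k
  assumes fI: "normal_f a1 a2 a3 a4 \<in> I" and gI: "normal_g b1 b2 \<in> I"
  defines "W \<equiv> defect (unit_f a1 a2 a3 a4) (unit_g b1 b2) s c15 c16 d10 d11"
  assumes W: "\<And>m. m < n \<Longrightarrow> W $ m = 0" and n: "n \<in> {2, 3, 8}"
  shows "W $ n = 0"
proof (rule I_square_gap[OF gI gI fI _ _ W n])
  show "coeff_\<alpha> s c15 c16 * normal_f a1 a2 a3 a4 + coeff_\<beta> s d10 d11 * normal_g b1 b2 \<in> I"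
    using fI gI coeff_carrier by (intro I_add I_mult)
  show "normal_g b1 b2 * normal_g b1 b2 - normal_f a1 a2 a3 a4 *
      (coeff_\<alpha> s c15 c16 * normal_f a1 a2 a3 a4 + coeff_\<beta> s d10 d11 * normal_g b1 b2) = fps_X ^ 51 * W"
    unfolding normal_f_eq normal_g_eq W_def by (rule defect_eq)
qed

text \<open>
  With \<open>s = -1/(a\<^sub>1 - b\<^sub>1)\<close>, which kills the coefficient at exponent 52, the ones at 53 and 54 give
  \<open>a\<^sub>2 = \<epsilon> (b\<^sub>1 - \<epsilon>)\<close> and \<open>b\<^sub>1 = 2 \<epsilon>\<close>, where \<open>\<epsilon> = a\<^sub>1 - b\<^sub>1\<close>; the one at 59 then determines \<open>a\<^sub>3\<close>.
\<close>

lemma ex_param: "\<exists>\<delta> \<epsilon> \<tau>. \<epsilon> \<noteq> 0 \<and> I = param_ideal \<delta> \<epsilon> \<tau>"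
proof -
  obtain a1 a2 a3 a4 b1 b2 where fI: "normal_f a1 a2 a3 a4 \<in> I" and gI: "normal_g b1 b2 \<in> I"
    using ex_normal_generators by blast
  define \<epsilon> where "\<epsilon> = a1 - b1"
  have nz: "\<epsilon> \<noteq> 0" using normal_generators_distinct[OF fI gI] by (simp add: \<epsilon>_def)
  have a1: "a1 = b1 + \<epsilon>" by (simp add: \<epsilon>_def)
  define W where "W = defect (unit_f a1 a2 a3 a4) (unit_g b1 b2) (- 1 / \<epsilon>) 0 0 0 0"
  note nth = defect_nth[of a1 a2 a3 a4 b1 b2 "- 1 / \<epsilon>" 0 0 0 0, folded W_def]
  note gap = normal_form_gap[OF fI gI, of _ "- 1 / \<epsilon>" 0 0 0 0, folded W_def]
  have W01: "W $ 0 = 0" "W $ 1 = 0" using nz unfolding nth a1 by simp_all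
  have W_lt_2: "W $ m = 0" if "m < 2" for m
    using W01 that by (cases "m = 0") (auto simp: less_2_cases_iff)
  have W2: "W $ 2 = 0" by (rule gap[OF W_lt_2]) simp_all
  have W_lt_3: "W $ m = 0" if "m < 3" for m
    using W_lt_2[of m] W2 that by (cases "m = 2") auto
  have W3: "W $ 3 = 0" by (rule gap[OF W_lt_3]) simp_all
  have a2: "a2 = \<epsilon> * (b1 - \<epsilon>)" using W2 nz unfolding nth a1 by (simp add: field_simps)
  have "\<epsilon> * (b1 * b1 - (b1 - \<epsilon>) * (b1 + \<epsilon> + \<epsilon>)) = 0"
    using W3 nz unfolding nth a1 a2 by (simp add: field_simps power2_eq_square)
  hence "\<epsilon> * (2 * \<epsilon> - b1) = 0" using nz by (simp add: algebra_simps)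
  hence b1: "b1 = 2 * \<epsilon>" using nz by simp
  have a1': "a1 = 3 * \<epsilon>" using a1 b1 by simp
  have a2': "a2 = \<epsilon> ^ 2" by (simp add: a2 b1 power2_eq_square)
  define y where "y = (a3 - b2) / \<epsilon> ^ 3 - 59 * \<epsilon> ^ 4"
  define W' where "W' = defect (unit_f (3 * \<epsilon>) (\<epsilon>\<^sup>2) a3 a4) (unit_g (2 * \<epsilon>) b2)
      (- 1 / \<epsilon>) (- (\<epsilon> ^ 3)) y (6 * \<epsilon> ^ 4 - y) (- 19 * \<epsilon> ^ 5 - \<epsilon> * y)"
  note W' = defect_special[OF nz y_def W'_def]
  have "W' $ 8 = 0"
    unfolding W'_def
    by (rule normal_form_gap[OF fI[unfolded a1' a2'] gI[unfolded b1]]) (use W'(1) in \<open>auto simp: W'_def\<close>)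
  hence a3: "a3 = 2 * b2 - 55 * \<epsilon> ^ 7" using W'(2) by simp
  have "I = genideal A511 {normal_f a1 a2 a3 a4, normal_g b1 b2}"
    using fI gI subdegree_normal by (intro generators)
  hence "I = param_ideal a4 \<epsilon> b2" unfolding param_ideal_eq a1' a2' a3 b1 .
  with nz show ?thesis by blast
qed

end

text \<open>
  The difference of two normal forms in \<open>I\<close> is supported at 21, 22, 27 and 33, none of which is an
  order in \<open>I\<close>, so it is zero.
\<close>

lemma param_ideal_unique:
  assumes nz: "\<epsilon> \<noteq> 0" and eq: "param_ideal \<delta> \<epsilon> \<tau> = param_ideal \<delta>' \<epsilon>' \<tau>'"
  shows "\<delta> = \<delta>' \<and> \<epsilon> = \<epsilon>' \<and> \<tau> = \<tau>'"
proof -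
  let ?f = "\<lambda>\<delta> \<epsilon> \<tau>. normal_f (3 * \<epsilon>) (\<epsilon> ^ 2) (2 * \<tau> - 55 * \<epsilon> ^ 7) \<delta>"
  let ?g = "\<lambda>\<epsilon> \<tau>. normal_g (2 * \<epsilon>) \<tau>"
  obtain \<alpha> \<beta> where "ulrich_pair (?f \<delta> \<epsilon> \<tau>) (?g \<epsilon> \<tau>) \<alpha> \<beta>" using ulrich_pair_normal[OF nz] by blast
  then interpret P: ulrich_pair "?f \<delta> \<epsilon> \<tau>" "?g \<epsilon> \<tau>" \<alpha> \<beta> .
  have "P.I = param_ideal \<delta>' \<epsilon>' \<tau>'" using P.I_eq eq by (simp add: param_ideal_eq)
  moreover have "{?f \<delta>' \<epsilon>' \<tau>', ?g \<epsilon>' \<tau>'} \<subseteq> param_ideal \<delta>' \<epsilon>' \<tau>'"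
    unfolding param_ideal_eq by (rule A511.genideal_self) (simp add: normal_carrier)
  ultimately have "?f \<delta>' \<epsilon>' \<tau>' \<in> P.I" "?g \<epsilon>' \<tau>' \<in> P.I" by simp_all
  hence d: "?f \<delta> \<epsilon> \<tau> - ?f \<delta>' \<epsilon>' \<tau>' \<in> P.I" "?g \<epsilon> \<tau> - ?g \<epsilon>' \<tau>' \<in> P.I"
    using P.f_in_I P.g_in_I P.I_diff by blast+
  have zero: "x = 0" if x: "x \<in> P.I" "\<And>n. n \<notin> {21, 22, 27, 33} \<Longrightarrow> x $ n = 0" for x
  proof (rule ccontr)
    assume nz: "x \<noteq> 0"
    hence "subdegree x \<in> {21, 22, 27, 33}" using x(2) nth_subdegree_nonzero by blast
    thus False using P.subdegree_I[OF x(1) nz] by auto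
  qed
  have "?f \<delta> \<epsilon> \<tau> - ?f \<delta>' \<epsilon>' \<tau>' = 0" by (rule zero[OF d(1)]) (auto simp: normal_f_nth)
  hence f: "?f \<delta> \<epsilon> \<tau> $ n = ?f \<delta>' \<epsilon>' \<tau>' $ n" for n by simp
  have "?g \<epsilon> \<tau> - ?g \<epsilon>' \<tau>' = 0" by (rule zero[OF d(2)]) (auto simp: normal_g_nth)
  hence g: "?g \<epsilon> \<tau> $ n = ?g \<epsilon>' \<tau>' $ n" for n by simp
  \<comment> \<open>\<open>\<epsilon> = 3 \<epsilon> - 2 \<epsilon>\<close> is recovered in characteristic 2 and 3 as well.\<close>
  have "3 * \<epsilon> = 3 * \<epsilon>'" "2 * \<epsilon> = 2 * \<epsilon>'" using f[of 21] g[of 27]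
    by (simp_all only: normal_f_nth normal_g_nth) simp_all
  hence "3 * \<epsilon> - 2 * \<epsilon> = 3 * \<epsilon>' - 2 * \<epsilon>'" by (simp only:)
  hence "\<epsilon> = \<epsilon>'" by (simp add: algebra_simps)
  moreover have "\<tau> = \<tau>'" "\<delta> = \<delta>'" using g[of 33] f[of 33] by (simp_all add: normal_f_nth normal_g_nth)
  ultimately show ?thesis by blast
qed

lemma data_20_26_imp_ulrich_pair:
  assumes "possesses_data semigroup_5_11 J 20 26" "ideal J A511"
  shows "\<exists>f g \<alpha> \<beta>. ulrich_pair f g \<alpha> \<beta> \<and> J = genideal A511 {f, g}"
proof -
  obtain f g where fg: "f \<in> J" "g \<in> J" "subdegree f = 20" "subdegree g = 26"
    "J = genideal A511 {f, g}" "ideal_prod A511 J J = (\<lambda>h. f * h) ` J"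
    using assms(1) unfolding possesses_data_def Let_def by metis
  have carr: "f \<in> carrier A511" "g \<in> carrier A511" using fg(1,2) ideal_A511_carrier[OF assms(2)] by blast+
  have "g \<otimes>\<^bsub>A511\<^esub> g \<in> ideal_prod A511 J J" using fg(2) by (intro ideal_prod.prod)
  then obtain h where h: "h \<in> J" "g * g = f * h" unfolding fg(6) by auto
  then obtain \<alpha> \<beta> where ab: "\<alpha> \<in> carrier A511" "\<beta> \<in> carrier A511" "h = \<alpha> * f + \<beta> * g"
    using fg(5) genideal_A511_pair[OF carr] by auto
  have "ulrich_pair f g \<alpha> \<beta>"
    by unfold_locales (use carr ab fg h in \<open>simp_all\<close>)
  thus ?thesis using fg(5) by blast
qed

theorem theorem5p1:
  shows "(Ulrich_ideals_with_data semigroup_5_11 20 26 :: 'k::field fps set set) =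
           {param_ideal \<delta> \<epsilon> \<tau> | \<delta> \<epsilon> \<tau>. \<epsilon> \<noteq> 0} \<and>
         (\<forall>I \<in> (Ulrich_ideals_with_data semigroup_5_11 20 26 :: 'k fps set set).
            \<exists>!(\<delta>, \<epsilon>, \<tau>). \<epsilon> \<noteq> 0 \<and> I = param_ideal \<delta> \<epsilon> \<tau>)"
proof -
  have param: "\<exists>\<delta> \<epsilon> \<tau>. \<epsilon> \<noteq> 0 \<and> J = param_ideal \<delta> \<epsilon> \<tau>"
    if "J \<in> Ulrich_ideals_with_data semigroup_5_11 20 26" for J :: "'k fps set"
  proof -
    have "possesses_data semigroup_5_11 J 20 26" "ideal J A511"
      using that by (auto simp: Ulrich_ideals_with_data_def Ulrich_ideal_def primary_to_def primary_ideal_def)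
    then obtain f g \<alpha> \<beta> where "ulrich_pair f g \<alpha> \<beta>" and J: "J = genideal A511 {f, g}"
      using data_20_26_imp_ulrich_pair by blast
    then interpret P: ulrich_pair f g \<alpha> \<beta> by blast
    show ?thesis using P.ex_param P.I_eq J by metis
  qed
  have Ulrich: "param_ideal \<delta> \<epsilon> \<tau> \<in> Ulrich_ideals_with_data semigroup_5_11 20 26"
    if "\<epsilon> \<noteq> 0" for \<delta> \<epsilon> \<tau> :: 'k
  proof -
    obtain \<alpha> \<beta> where "ulrich_pair (normal_f (3 * \<epsilon>) (\<epsilon> ^ 2) (2 * \<tau> - 55 * \<epsilon> ^ 7) \<delta>) (normal_g (2 * \<epsilon>) \<tau>) \<alpha> \<beta>"
      using ulrich_pair_normal \<open>\<epsilon> \<noteq> 0\<close> by blast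
    then interpret P: ulrich_pair "normal_f (3 * \<epsilon>) (\<epsilon> ^ 2) (2 * \<tau> - 55 * \<epsilon> ^ 7) \<delta>" "normal_g (2 * \<epsilon>) \<tau>" \<alpha> \<beta> .
    show ?thesis using P.I_in P.I_eq by (simp add: param_ideal_eq)
  qed
  show ?thesis
  proof (intro conjI ballI)
    show "(Ulrich_ideals_with_data semigroup_5_11 20 26 :: 'k fps set set) =
           {param_ideal \<delta> \<epsilon> \<tau> | \<delta> \<epsilon> \<tau>. \<epsilon> \<noteq> 0}" using param Ulrich by blast
    fix J :: "'k fps set" assume "J \<in> Ulrich_ideals_with_data semigroup_5_11 20 26"
    then obtain \<delta> \<epsilon> \<tau> where J: "\<epsilon> \<noteq> 0" "J = param_ideal \<delta> \<epsilon> \<tau>" using param by blast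
    show "\<exists>!(\<delta>, \<epsilon>, \<tau>). \<epsilon> \<noteq> 0 \<and> J = param_ideal \<delta> \<epsilon> \<tau>"
    proof (rule ex1I[of _ "(\<delta>, \<epsilon>, \<tau>)"])
      fix x assume x: "case x of (\<delta>, \<epsilon>, \<tau>) \<Rightarrow> \<epsilon> \<noteq> 0 \<and> J = param_ideal \<delta> \<epsilon> \<tau>"
      obtain \<delta>' \<epsilon>' \<tau>' where x': "x = (\<delta>', \<epsilon>', \<tau>')" by (cases x)
      show "x = (\<delta>, \<epsilon>, \<tau>)"
        using x J param_ideal_unique[of \<epsilon> \<delta> \<tau> \<delta>' \<epsilon>' \<tau>'] by (simp add: x')
    qed (use J in simp)
  qed
qed

end
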